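(* Let $n,r,d$ be integers with $1\leq r\leq n$ and $d\geq 3$. Then $\dim (\mathrm{WE}_{n,r+1}^d)\geq r(n+1)$.
   Context: Work over $\mathbb{C}$ and identify $\mathrm{Sym}^d(\mathbb{C}^{n+1})$ with the space $\mathbb{C}[x_0,\dots,x_n]_d$ of degree-$d$ forms. A linear form $L=a_0x_0+\dots+a_nx_n$ is identified with its coefficient vector $(a_0,\dots,a_n)\in\mathbb{C}^{n+1}$. The Veronese variety $V_n^d\subset\mathbb{P}(\mathrm{Sym}^d(\mathbb{C}^{n+1}))$ is the set of $[L^d]$ with $L$ a nonzero linear form. Set $\sigma_r^\circ(V_n^d)=\bigcup_{p_1,\dots,p_r\in V_n^d}\langle p_1,\dots,p_r\rangle$ (unions of projective linear spans). The Waring rank $\mathrm{rk}(F)$ of a form $F$ is the minimal $r$ such that $F=\sum_{i=1}^rL_i^d$ for linear forms $L_i$. The Waring locus $\mathcal{W}(F)$ is the set of $[L]\in\mathbb{P}(\mathrm{Sym}^1(\mathbb{C}^{n+1}))$ such that $F\in\langle L^d,L_2^d,\dots,L_r^d\rangle$ for some linear forms $L_2,\dots,L_r$, where $r=\mathrm{rk}(F)$. The eigenscheme $\mathrm{Eig}(F)\subset\mathbb{P}(\mathrm{Sym}^1(\mathbb{C}^{n+1}))$ is the scheme defined by the vanishing of the $2\times2$ minors of the $2\times(n+1)$ matrix with rows $\nabla F(x)$ and $x$; its points are the $[L]$ with $\nabla F(L)=\lambda L$ for some $\lambda\in\mathbb{C}$ (eigenvectors of $F$). The critical Waring variety of rank-$r$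 forms is the Zariski closure $$\mathrm{WE}_{n,r}^d=\overline{\{F\in\sigma_r^\circ(V_n^d)\mid \mathcal{W}(F)\cap\mathrm{Eig}(F)\neq\emptyset\}}\subset\mathbb{P}(\mathrm{Sym}^d(\mathbb{C}^{n+1})).$$ *)

theory Defs
  imports "HOL-Analysis.Abstract_Topology" "HOL-Library.Poly_Mapping" "HOL-Library.Extended_Nat"
    Complex_Main
begin

section \<open>Complex polynomials in variables indexed by a type\<close>

text \<open>A monomial is a finitely supported exponent function, and a polynomial is a finitely
  supported family of coefficients indexed by monomials; addition and multiplication are those of
  \<^theory>\<open>HOL-Library.Poly_Mapping\<close>.\<close>

type_synonym 'x monomial = "'x \<Rightarrow>\<^sub>0 nat"
type_synonym 'x cpoly = "'x monomial \<Rightarrow>\<^sub>0 complex"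

abbreviation coeff :: "'x cpoly \<Rightarrow> 'x monomial \<Rightarrow> complex"
  where "coeff \<equiv> Poly_Mapping.lookup"

definition smul :: "complex \<Rightarrow> 'x cpoly \<Rightarrow> 'x cpoly"
  where "smul c F = Poly_Mapping.map ((*) c) F"

lemma smul_conv_mult: "smul c F = Poly_Mapping.single 0 c * F"
  by (simp add: smul_def mult_map_scale_conv_mult)

global_interpretation cpoly: vector_space "smul :: complex \<Rightarrow> 'x cpoly \<Rightarrow> 'x cpoly"
  by unfold_locales
    (simp_all add: smul_conv_mult distrib_left distrib_right single_add mult_single
      flip: mult.assoc)

definition mdeg :: "'x monomial \<Rightarrow> nat"
  where "mdeg m = (\<Sum>i\<in>Poly_Mapping.keys m. Poly_Mapping.lookup m i)"

definition monomials :: "'x set \<Rightarrow> nat \<Rightarrow> 'x monomial set"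
  where "monomials I d = {m. Poly_Mapping.keys m \<subseteq> I \<and> mdeg m = d}"

text \<open>Homogeneous polynomials of degree \<open>d\<close> in the variables indexed by \<open>I\<close>, including \<open>0\<close>.
  The space of degree-\<open>d\<close> forms in \<open>x\<^sub>0, \<dots>, x\<^sub>n\<close> is \<open>forms {..n} d\<close>.\<close>

definition forms :: "'x set \<Rightarrow> nat \<Rightarrow> 'x cpoly set"
  where "forms I d = {F. Poly_Mapping.keys F \<subseteq> monomials I d}"

definition monomial_eval :: "('x \<Rightarrow> complex) \<Rightarrow> 'x monomial \<Rightarrow> complex"
  where "monomial_eval a m = (\<Prod>i\<in>Poly_Mapping.keys m. a i ^ Poly_Mapping.lookup m i)"

definition poly_eval :: "('x \<Rightarrow> complex) \<Rightarrow> 'x cpoly \<Rightarrow> complex"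
  where "poly_eval a F = (\<Sum>m\<in>Poly_Mapping.keys F. coeff F m * monomial_eval a m)"

text \<open>Formal partial derivative with respect to \<open>x\<^sub>i\<close>. The subtraction of exponents is truncated,
  but monomials not containing \<open>x\<^sub>i\<close> contribute \<open>0\<close>.\<close>

definition partial_deriv :: "'x \<Rightarrow> 'x cpoly \<Rightarrow> 'x cpoly"
  where "partial_deriv i F =
    (\<Sum>m\<in>Poly_Mapping.keys F. Poly_Mapping.single (m - Poly_Mapping.single i 1)
        (of_nat (Poly_Mapping.lookup m i) * coeff F m))"


section \<open>Projective spaces of forms\<close>

text \<open>A point of a projective space is a line through the origin, given as the set of its
  elements.\<close>

definition pt :: "'x cpoly \<Rightarrow> 'x cpoly set"
  where "pt F = cpoly.span {F}"

text \<open>The projective space of \<open>Sym\<^sup>d(\<complex>\<^sup>n\<^sup>+\<^sup>1)\<close>.\<close>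

definition proj_forms :: "nat \<Rightarrow> nat \<Rightarrow> nat cpoly set set"
  where "proj_forms n d = {pt F | F. F \<in> forms {..n} d \<and> F \<noteq> 0}"

text \<open>The homogeneous coordinates of \<open>[F]\<close> are the coefficients of \<open>F\<close>. Hence the homogeneous
  polynomials on the projective space of degree-\<open>d\<close> forms have their variables indexed by the
  degree-\<open>d\<close> monomials in \<open>x\<^sub>0, \<dots>, x\<^sub>n\<close>.\<close>

definition coord_forms :: "nat \<Rightarrow> nat \<Rightarrow> (nat monomial) cpoly set"
  where "coord_forms n d = (\<Union>e. forms (monomials {..n} d) e)"

definition zero_locus :: "nat \<Rightarrow> nat \<Rightarrow> (nat monomial) cpoly set \<Rightarrow> nat cpoly set set"
  where "zero_locus n d S =
    {pt F | F. F \<in> forms {..n} d \<and> F \<noteq> 0 \<and> (\<forall>G\<in>S. poly_eval (coeff F) G = 0)}"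

definition zariski_closed :: "nat \<Rightarrow> nat \<Rightarrow> nat cpoly set set \<Rightarrow> bool"
  where "zariski_closed n d Z \<longleftrightarrow> (\<exists>S \<subseteq> coord_forms n d. Z = zero_locus n d S)"

definition zariski :: "nat \<Rightarrow> nat \<Rightarrow> nat cpoly set topology"
  where "zariski n d =
    topology (\<lambda>U. U \<subseteq> proj_forms n d \<and> zariski_closed n d (proj_forms n d - U))"


subsection \<open>The Zariski topology is a topology\<close>

lemma mdeg_superset:
  assumes "finite A" "Poly_Mapping.keys m \<subseteq> A"
  shows "mdeg m = (\<Sum>i\<in>A. Poly_Mapping.lookup m i)"
  unfolding mdeg_def using assms
  by (intro sum.mono_neutral_left) (auto simp: in_keys_iff)

lemma mdeg_add: "mdeg (m + m') = mdeg m + mdeg m'"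
proof -
  let ?A = "Poly_Mapping.keys m \<union> Poly_Mapping.keys m'"
  have "mdeg (m + m') = (\<Sum>i\<in>?A. Poly_Mapping.lookup (m + m') i)"
    by (intro mdeg_superset) (use keys_add[of m m'] in auto)
  also have "\<dots> = (\<Sum>i\<in>?A. Poly_Mapping.lookup m i) + (\<Sum>i\<in>?A. Poly_Mapping.lookup m' i)"
    by (simp add: lookup_add sum.distrib)
  also have "\<dots> = mdeg m + mdeg m'"
    by (subst (1 2) mdeg_superset[where A = ?A]) auto
  finally show ?thesis .
qed

lemma monomial_eval_superset:
  assumes "finite A" "Poly_Mapping.keys m \<subseteq> A"
  shows "monomial_eval a m = (\<Prod>i\<in>A. a i ^ Poly_Mapping.lookup m i)"
  unfolding monomial_eval_def using assms
  by (intro prod.mono_neutral_left) (auto simp: in_keys_iff)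

lemma monomial_eval_add: "monomial_eval a (m + m') = monomial_eval a m * monomial_eval a m'"
proof -
  let ?A = "Poly_Mapping.keys m \<union> Poly_Mapping.keys m'"
  have "monomial_eval a (m + m') = (\<Prod>i\<in>?A. a i ^ Poly_Mapping.lookup (m + m') i)"
    by (intro monomial_eval_superset) (use keys_add[of m m'] in auto)
  also have "\<dots> = (\<Prod>i\<in>?A. a i ^ Poly_Mapping.lookup m i) * (\<Prod>i\<in>?A. a i ^ Poly_Mapping.lookup m' i)"
    by (simp add: lookup_add power_add prod.distrib)
  also have "\<dots> = monomial_eval a m * monomial_eval a m'"
    by (subst (1 2) monomial_eval_superset[where A = ?A]) auto
  finally show ?thesis .
qed

lemma monomial_eval_scale: "monomial_eval (\<lambda>i. c * a i) m = c ^ mdeg m * monomial_eval a m"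
  by (simp add: monomial_eval_def mdeg_def power_mult_distrib prod.distrib power_sum)

lemma poly_eval_superset:
  assumes "finite A" "Poly_Mapping.keys F \<subseteq> A"
  shows "poly_eval a F = (\<Sum>m\<in>A. coeff F m * monomial_eval a m)"
  unfolding poly_eval_def using assms
  by (intro sum.mono_neutral_left) (auto simp: in_keys_iff)

lemma poly_eval_zero: "poly_eval a 0 = 0"
  by (simp add: poly_eval_def)

lemma poly_eval_single: "poly_eval a (Poly_Mapping.single m c) = c * monomial_eval a m"
  by (subst poly_eval_superset[where A = "{m}"]) auto

lemma poly_eval_add: "poly_eval a (F + G) = poly_eval a F + poly_eval a G"
proof -
  let ?A = "Poly_Mapping.keys F \<union> Poly_Mapping.keys G"
  have "poly_eval a (F + G) = (\<Sum>m\<in>?A. coeff (F + G) m * monomial_eval a m)"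
    by (intro poly_eval_superset) (use keys_add[of F G] in auto)
  also have "\<dots> = (\<Sum>m\<in>?A. coeff F m * monomial_eval a m) + (\<Sum>m\<in>?A. coeff G m * monomial_eval a m)"
    by (simp add: lookup_add sum.distrib distrib_right)
  also have "\<dots> = poly_eval a F + poly_eval a G"
    by (subst (1 2) poly_eval_superset[where A = ?A]) auto
  finally show ?thesis .
qed

lemma poly_eval_sum: "poly_eval a (\<Sum>i\<in>I. f i) = (\<Sum>i\<in>I. poly_eval a (f i))"
  by (induction I rule: infinite_finite_induct) (simp_all add: poly_eval_zero poly_eval_add)

lemma cpoly_expansion: "F = (\<Sum>m\<in>Poly_Mapping.keys F. Poly_Mapping.single m (coeff F m))"
proof (rule poly_mapping_eqI)
  fix k
  have "coeff (\<Sum>m\<in>Poly_Mapping.keys F. Poly_Mapping.single m (coeff F m)) k =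
      (\<Sum>m\<in>Poly_Mapping.keys F. if m = k then coeff F m else 0)"
    by (auto simp: lookup_sum lookup_single when_def intro!: sum.cong)
  then show "coeff F k = coeff (\<Sum>m\<in>Poly_Mapping.keys F. Poly_Mapping.single m (coeff F m)) k"
    by (simp add: in_keys_iff)
qed

lemma poly_eval_mult: "poly_eval a (F * G) = poly_eval a F * poly_eval a G"
proof -
  have "F * G = (\<Sum>m\<in>Poly_Mapping.keys F. \<Sum>m'\<in>Poly_Mapping.keys G.
      Poly_Mapping.single (m + m') (coeff F m * coeff G m'))"
    by (subst cpoly_expansion[of F], subst cpoly_expansion[of G])
      (simp add: sum_product mult_single)
  then show ?thesis
    by (simp add: poly_eval_sum poly_eval_single monomial_eval_add)
      (simp add: poly_eval_def sum_product mult_ac)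
qed

lemma coeff_smul: "coeff (smul c F) = (\<lambda>m. c * coeff F m)"
  by (simp add: smul_def Poly_Mapping.map.rep_eq when_def fun_eq_iff)

lemma poly_eval_smul_form:
  assumes "G \<in> forms I e"
  shows "poly_eval (coeff (smul c F)) G = c ^ e * poly_eval (coeff F) G"
proof -
  have "mdeg m = e" if "m \<in> Poly_Mapping.keys G" for m
    using assms that by (auto simp: forms_def monomials_def)
  then show ?thesis
    by (simp add: poly_eval_def sum_distrib_left coeff_smul monomial_eval_scale mult_ac)
qed

lemma pt_eqD:
  assumes "pt F = pt G"
  obtains c where "F = smul c G"
proof -
  have "F \<in> pt G"
    using assms cpoly.span_base[of F "{F}"] by (auto simp: pt_def)
  then show ?thesis
    using that by (auto simp: pt_def cpoly.span_singleton)
qed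

lemma poly_eval_pt_cong:
  assumes "pt F = pt F'" "G \<in> coord_forms n d" "poly_eval (coeff F') G = 0"
  shows "poly_eval (coeff F) G = 0"
proof -
  obtain c where "F = smul c F'"
    using pt_eqD[OF assms(1)] .
  then show ?thesis
    using assms(2,3) by (auto simp: coord_forms_def poly_eval_smul_form)
qed

lemma pt_in_zero_locus_iff:
  assumes "F \<in> forms {..n} d" "F \<noteq> 0" "S \<subseteq> coord_forms n d"
  shows "pt F \<in> zero_locus n d S \<longleftrightarrow> (\<forall>G\<in>S. poly_eval (coeff F) G = 0)"
  using assms poly_eval_pt_cong unfolding zero_locus_def by blast

lemma zero_locus_subset: "zero_locus n d S \<subseteq> proj_forms n d"
  by (auto simp: zero_locus_def proj_forms_def)

lemma forms_mult:
  assumes "F \<in> forms I d" "G \<in> forms I e"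
  shows "F * G \<in> forms I (d + e)"
proof -
  have "m + m' \<in> monomials I (d + e)"
    if "m \<in> Poly_Mapping.keys F" "m' \<in> Poly_Mapping.keys G" for m m'
  proof -
    have "m \<in> monomials I d" "m' \<in> monomials I e"
      using assms that by (auto simp: forms_def)
    then show ?thesis
      using keys_add[of m m'] by (simp add: monomials_def mdeg_add) blast
  qed
  then show ?thesis
    using keys_mult[of F G] by (auto simp: forms_def)
qed

lemma zariski_closed_Un:
  assumes "zariski_closed n d Y" "zariski_closed n d Z"
  shows "zariski_closed n d (Y \<union> Z)"
proof -
  obtain S T where ST: "S \<subseteq> coord_forms n d" "Y = zero_locus n d S"
      "T \<subseteq> coord_forms n d" "Z = zero_locus n d T"
    using assms by (auto simp: zariski_closed_def)
  let ?P = "{G * H | G H. G \<in> S \<and> H \<in> T}"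
  have P: "?P \<subseteq> coord_forms n d"
  proof
    fix K
    assume "K \<in> ?P"
    then obtain G H where K: "K = G * H" "G \<in> S" "H \<in> T"
      by blast
    then obtain e e' where "G \<in> forms (monomials {..n} d) e" "H \<in> forms (monomials {..n} d) e'"
      using ST(1,3) unfolding coord_forms_def by blast
    then show "K \<in> coord_forms n d"
      unfolding K(1) coord_forms_def using forms_mult by blast
  qed
  have "Y \<union> Z = zero_locus n d ?P"
  proof (rule set_eqI)
    fix p
    show "p \<in> Y \<union> Z \<longleftrightarrow> p \<in> zero_locus n d ?P"
    proof (cases "p \<in> proj_forms n d")
      case True
      then obtain F where F: "p = pt F" "F \<in> forms {..n} d" "F \<noteq> 0"
        by (auto simp: proj_forms_def)
      have "p \<in> zero_locus n d ?P \<longleftrightarrow>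
          (\<forall>G\<in>S. \<forall>H\<in>T. poly_eval (coeff F) G = 0 \<or> poly_eval (coeff F) H = 0)"
      proof -
        have "p \<in> zero_locus n d ?P \<longleftrightarrow> (\<forall>G\<in>S. \<forall>H\<in>T. poly_eval (coeff F) (G * H) = 0)"
          unfolding F(1) pt_in_zero_locus_iff[OF F(2,3) P] by blast
        then show ?thesis
          by (simp add: poly_eval_mult)
      qed
      moreover have "p \<in> Y \<union> Z \<longleftrightarrow>
          (\<forall>G\<in>S. poly_eval (coeff F) G = 0) \<or> (\<forall>H\<in>T. poly_eval (coeff F) H = 0)"
        using F ST by (simp add: pt_in_zero_locus_iff)
      ultimately show ?thesis
        by blast
    next
      case False
      then show ?thesis
        using zero_locus_subset ST by blast
    qed
  qed
  with P show ?thesis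
    by (auto simp: zariski_closed_def)
qed

lemma zariski_closed_INT:
  assumes "\<And>Z. Z \<in> \<Z> \<Longrightarrow> zariski_closed n d Z"
  shows "zariski_closed n d (proj_forms n d \<inter> \<Inter>\<Z>)"
proof -
  have "\<forall>Z\<in>\<Z>. \<exists>S. S \<subseteq> coord_forms n d \<and> Z = zero_locus n d S"
    using assms by (auto simp: zariski_closed_def)
  then obtain S where S: "\<And>Z. Z \<in> \<Z> \<Longrightarrow> S Z \<subseteq> coord_forms n d"
      "\<And>Z. Z \<in> \<Z> \<Longrightarrow> Z = zero_locus n d (S Z)"
    by metis
  have U: "(\<Union>Z\<in>\<Z>. S Z) \<subseteq> coord_forms n d"
    using S(1) by blast
  have "proj_forms n d \<inter> \<Inter>\<Z> = zero_locus n d (\<Union>Z\<in>\<Z>. S Z)"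
  proof (rule set_eqI)
    fix p
    show "p \<in> proj_forms n d \<inter> \<Inter>\<Z> \<longleftrightarrow> p \<in> zero_locus n d (\<Union>Z\<in>\<Z>. S Z)"
    proof (cases "p \<in> proj_forms n d")
      case True
      then obtain F where F: "p = pt F" "F \<in> forms {..n} d" "F \<noteq> 0"
        by (auto simp: proj_forms_def)
      have "p \<in> Z \<longleftrightarrow> (\<forall>G\<in>S Z. poly_eval (coeff F) G = 0)" if "Z \<in> \<Z>" for Z
        using pt_in_zero_locus_iff[OF F(2,3) S(1)[OF that]] S(2)[OF that] F(1) by simp
      then show ?thesis
        using True unfolding F(1) pt_in_zero_locus_iff[OF F(2,3) U] by auto
    next
      case False
      then show ?thesis
        using zero_locus_subset by blast
    qed
  qed
  with U show ?thesis
    by (auto simp: zariski_closed_def)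
qed

lemma istopology_zariski:
  "istopology (\<lambda>U. U \<subseteq> proj_forms n d \<and> zariski_closed n d (proj_forms n d - U))"
proof -
  have "zariski_closed n d (proj_forms n d - U \<inter> V)"
    if "zariski_closed n d (proj_forms n d - U)" "zariski_closed n d (proj_forms n d - V)" for U V
    using zariski_closed_Un[OF that] by (simp add: Diff_Int)
  moreover have "zariski_closed n d (proj_forms n d - \<Union>\<K>)"
    if "\<forall>K\<in>\<K>. zariski_closed n d (proj_forms n d - K)" for \<K>
  proof -
    have "zariski_closed n d (proj_forms n d \<inter> \<Inter>((\<lambda>K. proj_forms n d - K) ` \<K>))"
      by (rule zariski_closed_INT) (use that in blast)
    moreover have "proj_forms n d \<inter> \<Inter>((\<lambda>K. proj_forms n d - K) ` \<K>) = proj_forms n d - \<Union>\<K>"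
      by blast
    ultimately show ?thesis
      by (simp only:)
  qed
  ultimately show ?thesis
    unfolding istopology_def by (simp add: le_infI1 Sup_le_iff)
qed

lemma openin_zariski_iff:
  "openin (zariski n d) U \<longleftrightarrow>
    U \<subseteq> proj_forms n d \<and> zariski_closed n d (proj_forms n d - U)"
  by (simp add: zariski_def topology_inverse'[OF istopology_zariski])

lemma zariski_closed_proj_forms: "zariski_closed n d (proj_forms n d)"
  using zariski_closed_INT[of "{}" n d] by simp

lemma zariski_closed_empty: "zariski_closed n d {}"
proof -
  have "1 \<in> coord_forms n d"
    by (auto simp: coord_forms_def forms_def monomials_def mdeg_def)
  moreover have "zero_locus n d {1} = {}"
    by (auto simp: zero_locus_def poly_eval_def monomial_eval_def)
  ultimately show ?thesis
    unfolding zariski_closed_def by (metis empty_subsetI insert_subset)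
qed

lemma topspace_zariski: "topspace (zariski n d) = proj_forms n d"
proof
  show "topspace (zariski n d) \<subseteq> proj_forms n d"
    using openin_topspace openin_zariski_iff by blast
  have "openin (zariski n d) (proj_forms n d)"
    by (simp add: openin_zariski_iff zariski_closed_empty)
  then show "proj_forms n d \<subseteq> topspace (zariski n d)"
    by (rule openin_subset)
qed

lemma closedin_zariski_iff: "closedin (zariski n d) Z \<longleftrightarrow> zariski_closed n d Z"
proof -
  have "zariski_closed n d Z \<Longrightarrow> Z \<subseteq> proj_forms n d"
    using zero_locus_subset by (auto simp: zariski_closed_def)
  then show ?thesis
    by (auto simp: closedin_def topspace_zariski openin_zariski_iff double_diff)
qed


section \<open>Dimension of a topological space\<close>

definition irreducible_closedin :: "'a topology \<Rightarrow> 'a set \<Rightarrow> bool"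
  where "irreducible_closedin X Z \<longleftrightarrow> closedin X Z \<and> Z \<noteq> {} \<and>
    (\<forall>A B. closedin X A \<and> closedin X B \<and> Z = A \<union> B \<longrightarrow> Z = A \<or> Z = B)"

text \<open>The supremum of the lengths \<open>m\<close> of chains \<open>Z\<^sub>0 \<subset> \<dots> \<subset> Z\<^sub>m\<close> of irreducible closed subsets.
  With this convention the empty space has dimension \<open>0\<close>.\<close>

definition krull_dim :: "'a topology \<Rightarrow> enat"
  where "krull_dim X = Sup {enat m | m. \<exists>Z :: nat \<Rightarrow> 'a set.
    (\<forall>i\<le>m. irreducible_closedin X (Z i)) \<and> (\<forall>i<m. Z i \<subset> Z (Suc i))}"


section \<open>Waring rank, Waring locus, eigenscheme and critical Waring varieties\<close>

definition veronese :: "nat \<Rightarrow> nat \<Rightarrow> nat cpoly set set"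
  where "veronese n d = {pt (L ^ d) | L. L \<in> forms {..n} 1 \<and> L \<noteq> 0}"

definition proj_span :: "'x cpoly set set \<Rightarrow> 'x cpoly set set"
  where "proj_span A = {pt F | F. F \<in> cpoly.span (\<Union>A) \<and> F \<noteq> 0}"

definition secant_open :: "nat \<Rightarrow> nat \<Rightarrow> nat \<Rightarrow> nat cpoly set set"
  where "secant_open n r d =
    (\<Union>p \<in> {p :: nat \<Rightarrow> nat cpoly set. \<forall>i\<in>{1..r}. p i \<in> veronese n d}. proj_span (p ` {1..r}))"

definition waring_rank :: "nat \<Rightarrow> nat \<Rightarrow> nat cpoly \<Rightarrow> nat"
  where "waring_rank n d F = (LEAST r. \<exists>L :: nat \<Rightarrow> nat cpoly.
    (\<forall>i\<in>{1..r}. L i \<in> forms {..n} 1) \<and> F = (\<Sum>i\<in>{1..r}. L i ^ d))"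

definition waring_locus :: "nat \<Rightarrow> nat \<Rightarrow> nat cpoly \<Rightarrow> nat cpoly set set"
  where "waring_locus n d F = {pt L | L. L \<in> forms {..n} 1 \<and> L \<noteq> 0 \<and>
    (\<exists>L' :: nat \<Rightarrow> nat cpoly. (\<forall>i\<in>{2..waring_rank n d F}. L' i \<in> forms {..n} 1) \<and>
      F \<in> cpoly.span (insert (L ^ d) ((\<lambda>i. L' i ^ d) ` {2..waring_rank n d F})))}"

definition linear_coeff :: "nat cpoly \<Rightarrow> nat \<Rightarrow> complex"
  where "linear_coeff L i = coeff L (Poly_Mapping.single i 1)"

text \<open>The points of the eigenscheme, i.e. the common zeros of the \<open>2 \<times> 2\<close> minors of the matrix
  with rows \<open>\<nabla>F(x)\<close> and \<open>x\<close>. The scheme structure is not recorded. A linear form is identified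
  with its coefficient vector, so the pairing implicit here is bilinear, not Hermitian.\<close>

definition eig :: "nat \<Rightarrow> nat cpoly \<Rightarrow> nat cpoly set set"
  where "eig n F = {pt L | L. L \<in> forms {..n} 1 \<and> L \<noteq> 0 \<and>
    (\<forall>i\<le>n. \<forall>j\<le>n.
      poly_eval (linear_coeff L) (partial_deriv i F) * linear_coeff L j -
      poly_eval (linear_coeff L) (partial_deriv j F) * linear_coeff L i = 0)}"

definition critical_waring_variety :: "nat \<Rightarrow> nat \<Rightarrow> nat \<Rightarrow> nat cpoly set set"
  where "critical_waring_variety n r d = zariski n d closure_of
    {pt F | F. F \<in> forms {..n} d \<and> F \<noteq> 0 \<and> pt F \<in> secant_open n r d \<and>
      waring_locus n d F \<inter> eig n F \<noteq> {}}"

end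

theory Submission
  imports "Jordan_Normal_Form.Determinant" Defs
begin

text \<open>
  If \<open>L\<^sub>1, \<dots>, L\<^sub>r\<close> are orthogonal to \<open>L\<^sub>0\<close> for the bilinear pairing, then \<open>L\<^sub>0\<close> is an eigenvector of
  \<open>F = L\<^sub>0\<^sup>d + \<dots> + L\<^sub>r\<^sup>d\<close>, because the gradient of \<open>F\<close> at \<open>L\<^sub>0\<close> is
  \<open>d \<Sum> (L\<^sub>i \<bullet> L\<^sub>0)\<^sup>d\<^sup>-\<^sup>1 L\<^sub>i\<close>. If moreover the \<open>L\<^sub>i\<close> are independent, which is possible since
  \<open>r \<le> n\<close>, then \<open>F\<close> has rank \<open>r + 1\<close>, and \<open>L\<^sub>0\<close> lies in its Waring locus. Normalising
  \<open>L\<^sub>0 = (1, a)\<close> and writing \<open>L\<^sub>i = (- b\<^sub>i \<bullet> a, b\<^sub>i)\<close> gives a family with \<open>n + r n\<close> free parameters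
  whose generic member lies in the critical Waring variety. Its dimension is \<open>r n + n \<ge> r (n + 1)\<close>.

  The dimension is bounded below by an explicit chain. The parameters are switched on one at a
  time, first the coordinates of \<open>a\<close>, then those of \<open>b\<^sub>1\<close>, then those of \<open>b\<^sub>2\<close>, and so on; the links
  of the chain are the Zariski closures of the resulting subfamilies. Each is irreducible because
  any two members are joined by a polynomial curve inside the subfamily
  (\<open>irreducible_cone_closure\<close>). The same curves show that it is enough to know that generic members
  lie in the variety (\<open>cone_closure_generic_subset\<close>).

  Strictness comes from one family of equations. When the \<open>j\<close>-th coordinate of \<open>L\<^sub>k\<close> is switched
  on, the form is \<open>L\<^sub>0\<^sup>d + \<dots> + L\<^sub>k\<^sup>d\<close>, and the Hessian of \<open>\<partial>\<^sub>j\<^sup>d\<^sup>-\<^sup>2 F\<close> is up to a factor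
  \<open>\<Sum> (L\<^sub>i)\<^sub>j\<^sup>d\<^sup>-\<^sup>2 L\<^sub>i L\<^sub>i\<^sup>T\<close>. Its minors of size \<open>k + 1\<close> all vanish as long as \<open>(L\<^sub>k)\<^sub>j = 0\<close>, and one
  of them is nonzero once the \<open>L\<^sub>i\<close> are independent with nonzero \<open>j\<close>-th coordinates
  (\<open>minor_power_sum\<close>, \<open>exists_config_with_minor\<close>). The same minors of size \<open>r + 1\<close> also bound the
  Waring rank from below (\<open>waring_rank_eqI\<close>).
\<close>

section \<open>Powers of linear forms\<close>

definition linear_form :: "nat \<Rightarrow> (nat \<Rightarrow> complex) \<Rightarrow> nat cpoly"
  where "linear_form n a = (\<Sum>i\<le>n. Poly_Mapping.single (Poly_Mapping.single i 1) (a i))"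

text \<open>The recursion removes one variable at a time, so that it follows the expansion of
  \<open>L\<^sup>d\<^sup>+\<^sup>1 = L * L\<^sup>d\<close>. The value is \<open>0\<close> when the monomial does not have degree \<open>d\<close> or
  involves a variable with index above \<open>n\<close>.\<close>

fun multinomial :: "nat \<Rightarrow> nat \<Rightarrow> nat monomial \<Rightarrow> nat"
  where "multinomial n 0 m = (if m = 0 then 1 else 0)"
  | "multinomial n (Suc d) m =
      (\<Sum>i\<in>{..n} \<inter> Poly_Mapping.keys m. multinomial n d (m - Poly_Mapping.single i 1))"

lemma single_add_eq_iff:
  fixes m m' :: "'x monomial"
  shows "Poly_Mapping.single i 1 + m' = m \<longleftrightarrow>
    i \<in> Poly_Mapping.keys m \<and> m' = m - Poly_Mapping.single i 1"
proof
  assume "Poly_Mapping.single i 1 + m' = m"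
  then show "i \<in> Poly_Mapping.keys m \<and> m' = m - Poly_Mapping.single i 1"
    by (auto simp: in_keys_iff lookup_add)
next
  assume *: "i \<in> Poly_Mapping.keys m \<and> m' = m - Poly_Mapping.single i 1"
  show "Poly_Mapping.single i 1 + m' = m"
    by (rule poly_mapping_eqI)
      (use * in \<open>auto simp: lookup_add lookup_minus lookup_single when_def in_keys_iff\<close>)
qed

lemma coeff_variable_mult:
  "coeff (Poly_Mapping.single (Poly_Mapping.single i 1) c * P) m =
    (if i \<in> Poly_Mapping.keys m then c * coeff P (m - Poly_Mapping.single i 1) else 0)"
proof -
  have "coeff (Poly_Mapping.single (Poly_Mapping.single i 1) c * P) m =
      (\<Sum>m'\<in>Poly_Mapping.keys P. if Poly_Mapping.single i 1 + m' = m then c * coeff P m' else 0)"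
    by (subst (1) cpoly_expansion[of P])
      (auto simp: sum_distrib_left mult_single lookup_sum lookup_single when_def intro!: sum.cong)
  also have "\<dots> = (if i \<in> Poly_Mapping.keys m then c * coeff P (m - Poly_Mapping.single i 1) else 0)"
    by (simp add: single_add_eq_iff in_keys_iff del: One_nat_def)
  finally show ?thesis .
qed

lemma monomial_eval_diff:
  assumes "i \<in> Poly_Mapping.keys m"
  shows "a i * monomial_eval a (m - Poly_Mapping.single i 1) = monomial_eval a m"
proof -
  have "m = Poly_Mapping.single i 1 + (m - Poly_Mapping.single i 1)"
    using assms single_add_eq_iff[of i "m - Poly_Mapping.single i 1" m] by simp
  moreover have "monomial_eval a (Poly_Mapping.single i 1) = a i"
    by (simp add: monomial_eval_def)
  ultimately show ?thesis
    by (metis monomial_eval_add)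
qed

lemma coeff_linear_form_power:
  "coeff (linear_form n a ^ d) m = of_nat (multinomial n d m) * monomial_eval a m"
proof (induction d arbitrary: m)
  case 0
  show ?case
    by (auto simp: lookup_one when_def monomial_eval_def)
next
  case (Suc d)
  have "linear_form n a ^ Suc d =
      (\<Sum>i\<le>n. Poly_Mapping.single (Poly_Mapping.single i 1) (a i) * linear_form n a ^ d)"
    by (simp add: linear_form_def[of n a] sum_distrib_right)
  then have "coeff (linear_form n a ^ Suc d) m =
      (\<Sum>i\<le>n. if i \<in> Poly_Mapping.keys m
        then a i * coeff (linear_form n a ^ d) (m - Poly_Mapping.single i 1) else 0)"
    by (simp add: lookup_sum coeff_variable_mult del: One_nat_def power_Suc)
  also have "\<dots> = (\<Sum>i\<in>{..n} \<inter> Poly_Mapping.keys m.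
      a i * coeff (linear_form n a ^ d) (m - Poly_Mapping.single i 1))"
    by (simp add: sum.inter_restrict del: One_nat_def)
  also have "\<dots> = (\<Sum>i\<in>{..n} \<inter> Poly_Mapping.keys m.
      of_nat (multinomial n d (m - Poly_Mapping.single i 1)) * monomial_eval a m)"
  proof (intro sum.cong refl)
    fix i
    assume "i \<in> {..n} \<inter> Poly_Mapping.keys m"
    then have "a i * monomial_eval a (m - Poly_Mapping.single i 1) = monomial_eval a m"
      by (intro monomial_eval_diff) blast
    then show "a i * coeff (linear_form n a ^ d) (m - Poly_Mapping.single i 1) =
        of_nat (multinomial n d (m - Poly_Mapping.single i 1)) * monomial_eval a m"
      unfolding Suc.IH by (metis mult.left_commute)
  qed
  finally show ?case
    by (simp add: sum_distrib_right)
qed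

lemma mdeg_single [simp]: "mdeg (Poly_Mapping.single i c) = c"
  by (cases "c = 0") (simp_all add: mdeg_def)

lemma multinomial_pos:
  assumes "m \<in> monomials {..n} d"
  shows "multinomial n d m > 0"
  using assms
proof (induction d arbitrary: m)
  case 0
  then have "m = 0"
    by (intro poly_mapping_eqI) (auto simp: monomials_def mdeg_def in_keys_iff)
  then show ?case
    by simp
next
  case (Suc d)
  then have "Poly_Mapping.keys m \<noteq> {}"
    by (auto simp: monomials_def mdeg_def)
  then obtain i where i: "i \<in> Poly_Mapping.keys m"
    by blast
  define m' where "m' = m - Poly_Mapping.single i 1"
  have m: "m = Poly_Mapping.single i 1 + m'"
    using i single_add_eq_iff[of i m' m] by (simp add: m'_def)
  have "Poly_Mapping.keys m' \<subseteq> Poly_Mapping.keys m"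
    by (auto simp: m'_def in_keys_iff lookup_minus)
  then have "m' \<in> monomials {..n} d"
    using Suc.prems mdeg_add[of "Poly_Mapping.single i 1" m'] m by (auto simp: monomials_def)
  then have "multinomial n d m' > 0"
    by (rule Suc.IH)
  moreover have "i \<in> {..n} \<inter> Poly_Mapping.keys m"
    using i Suc.prems by (auto simp: monomials_def)
  ultimately show ?case
    unfolding multinomial.simps m'_def by (metis finite_Int finite_atMost gr0I not_gr0 sum_eq_0_iff)
qed

lemma forms_zero: "0 \<in> forms I d"
  by (simp add: forms_def)

lemma forms_add:
  assumes "F \<in> forms I d" "G \<in> forms I d"
  shows "F + G \<in> forms I d"
  using assms keys_add[of F G] by (auto simp: forms_def)

lemma forms_sum:
  assumes "\<And>i. i \<in> A \<Longrightarrow> f i \<in> forms I d"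
  shows "(\<Sum>i\<in>A. f i) \<in> forms I d"
  using assms by (induction A rule: infinite_finite_induct) (auto intro: forms_zero forms_add)

lemma forms_const: "Poly_Mapping.single 0 c \<in> forms I 0"
  by (auto simp: forms_def monomials_def mdeg_def)

lemma forms_prod:
  assumes "finite A" "\<And>i. i \<in> A \<Longrightarrow> f i \<in> forms I e"
  shows "(\<Prod>i\<in>A. f i) \<in> forms I (e * card A)"
  using assms
  by (induction A rule: finite_induct) (auto intro: forms_mult simp: forms_const[of 1, simplified])

lemma forms_power: "F \<in> forms I e \<Longrightarrow> F ^ d \<in> forms I (e * d)"
  using forms_prod[of "{..<d}" "\<lambda>_. F" I e] by simp

lemma linear_form_in_forms: "linear_form n a \<in> forms {..n} 1"
  unfolding linear_form_def by (intro forms_sum) (auto simp: forms_def monomials_def)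

lemma linear_form_power_in_forms: "linear_form n a ^ d \<in> forms {..n} d"
  using forms_power[OF linear_form_in_forms] by simp

lemma linear_coeff_linear_form:
  "linear_coeff (linear_form n a) i = (if i \<le> n then a i else 0)"
proof -
  have "(Poly_Mapping.single j 1 = (Poly_Mapping.single i 1 :: nat monomial)) \<longleftrightarrow> j = i" for j
    by (metis lookup_single_eq lookup_single_not_eq zero_neq_one)
  then show ?thesis
    by (simp add: linear_coeff_def linear_form_def lookup_sum lookup_single when_def)
qed

lemma linear_form_linear_coeff:
  assumes "L \<in> forms {..n} 1"
  shows "L = linear_form n (linear_coeff L)"
proof (rule poly_mapping_eqI)
  fix m
  show "coeff L m = coeff (linear_form n (linear_coeff L)) m"
  proof (cases "m \<in> monomials {..n} 1")
    case True
    then have "mdeg m = 1" "Poly_Mapping.keys m \<subseteq> {..n}"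
      by (auto simp: monomials_def)
    then have "(\<Sum>i\<in>Poly_Mapping.keys m. Poly_Mapping.lookup m i) = 1"
      by (simp add: mdeg_def)
    then obtain i where "i \<in> Poly_Mapping.keys m" "Poly_Mapping.lookup m i = 1"
        "\<forall>j\<in>Poly_Mapping.keys m. i \<noteq> j \<longrightarrow> Poly_Mapping.lookup m j = 0"
      using sum_eq_1_iff[of "Poly_Mapping.keys m" "Poly_Mapping.lookup m"] by auto
    moreover have "m = Poly_Mapping.single i 1"
    proof (rule poly_mapping_eqI)
      fix j
      show "Poly_Mapping.lookup m j = Poly_Mapping.lookup (Poly_Mapping.single i 1) j"
        using calculation by (cases "j \<in> Poly_Mapping.keys m")
          (auto simp: lookup_single when_def in_keys_iff)
    qed
    ultimately have "m = Poly_Mapping.single i 1" "i \<le> n"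
      using \<open>Poly_Mapping.keys m \<subseteq> {..n}\<close> by blast+
    then show ?thesis
      using linear_coeff_linear_form[of n "linear_coeff L" i] by (simp add: linear_coeff_def)
  next
    case False
    then show ?thesis
      using assms linear_form_in_forms[of n "linear_coeff L"]
      by (auto simp: forms_def in_keys_iff dest!: subsetD[of _ _ m])
  qed
qed

lemma poly_eval_linear_form: "poly_eval x (linear_form n a) = (\<Sum>i\<le>n. a i * x i)"
  by (simp add: linear_form_def poly_eval_sum poly_eval_single monomial_eval_def)

lemma poly_eval_one: "poly_eval x 1 = 1"
  by (simp add: poly_eval_def monomial_eval_def)

lemma poly_eval_power: "poly_eval x (F ^ d) = poly_eval x F ^ d"
  by (induction d) (simp_all add: poly_eval_mult poly_eval_one)


section \<open>Gradients\<close>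

text \<open>Evaluated formal partial derivatives are identified with analytic ones. The gradient of a
  sum of powers then follows from the analytic chain rule and uniqueness of derivatives, without a
  Leibniz rule for formal derivatives.\<close>

lemma has_derivative_monomial_eval:
  "((\<lambda>u. monomial_eval (x(i := u)) m) has_field_derivative
    of_nat (Poly_Mapping.lookup m i) * monomial_eval x (m - Poly_Mapping.single i 1)) (at (x i))"
proof -
  let ?A = "insert i (Poly_Mapping.keys m)"
  let ?c = "\<Prod>l\<in>?A - {i}. x l ^ Poly_Mapping.lookup m l"
  have "monomial_eval (x(i := u)) m = u ^ Poly_Mapping.lookup m i * ?c" for u
    by (subst monomial_eval_superset[of ?A])
      (auto simp: prod.remove[of ?A i] intro!: arg_cong2[where f = "(*)"] prod.cong)
  moreover have "monomial_eval x (m - Poly_Mapping.single i 1) = x i ^ (Poly_Mapping.lookup m i - 1) * ?c"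
    by (subst monomial_eval_superset[of ?A])
      (auto simp: prod.remove[of ?A i] lookup_minus in_keys_iff lookup_single when_def
        intro!: arg_cong2[where f = "(*)"] prod.cong)
  ultimately show ?thesis
    by (auto intro!: derivative_eq_intros)
qed

lemma has_derivative_poly_eval:
  "((\<lambda>u. poly_eval (x(i := u)) F) has_field_derivative poly_eval x (partial_deriv i F)) (at (x i))"
proof -
  have "poly_eval x (partial_deriv i F) = (\<Sum>m\<in>Poly_Mapping.keys F. coeff F m *
      (of_nat (Poly_Mapping.lookup m i) * monomial_eval x (m - Poly_Mapping.single i 1)))"
    by (simp add: partial_deriv_def poly_eval_sum poly_eval_single mult_ac)
  then show ?thesis
    unfolding poly_eval_def by (simp only:) (intro DERIV_sum DERIV_cmult has_derivative_monomial_eval)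
qed

lemma gradient_power_sum:
  assumes "i \<le> n"
  shows "poly_eval x (partial_deriv i (\<Sum>k\<in>K. linear_form n (a k) ^ d)) =
    (\<Sum>k\<in>K. of_nat d * (\<Sum>l\<le>n. a k l * x l) ^ (d - 1) * a k i)"
proof -
  have "(\<Sum>l\<le>n. a k l * (x(i := u)) l) = a k i * u + (\<Sum>l\<in>{..n} - {i}. a k l * x l)" for k u
    using assms by (subst sum.remove[of "{..n}" i]) (auto intro!: sum.cong)
  then have lin: "((\<lambda>u. \<Sum>l\<le>n. a k l * (x(i := u)) l) has_field_derivative a k i) (at (x i))" for k
    by (auto intro!: derivative_eq_intros simp del: fun_upd_apply)
  have "((\<lambda>u. \<Sum>k\<in>K. (\<Sum>l\<le>n. a k l * (x(i := u)) l) ^ d) has_field_derivative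
      (\<Sum>k\<in>K. of_nat d * (\<Sum>l\<le>n. a k l * x l) ^ (d - 1) * a k i)) (at (x i))"
    by (intro DERIV_sum DERIV_cong[OF DERIV_power[OF lin]]) (simp add: mult_ac)
  moreover have "poly_eval y (\<Sum>k\<in>K. linear_form n (a k) ^ d) = (\<Sum>k\<in>K. (\<Sum>l\<le>n. a k l * y l) ^ d)" for y
    by (simp add: poly_eval_sum poly_eval_power poly_eval_linear_form)
  ultimately show ?thesis
    using has_derivative_poly_eval[of x i "\<Sum>k\<in>K. linear_form n (a k) ^ d"]
    by (auto dest: DERIV_unique simp del: fun_upd_apply)
qed


section \<open>Minors of second derivatives\<close>

text \<open>As a linear functional on forms of degree \<open>d\<close>, this is the apolar pairing with
  \<open>y\<^sub>j\<^sup>d\<^sup>-\<^sup>2 (u \<bullet> y) (v \<bullet> y)\<close>. Division by the multinomial coefficients makes its value on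
  \<open>L\<^sup>d\<close> the value of that form at the coefficient vector of \<open>L\<close>.\<close>

definition apolar_functional ::
    "nat \<Rightarrow> nat \<Rightarrow> nat \<Rightarrow> (nat \<Rightarrow> complex) \<Rightarrow> (nat \<Rightarrow> complex) \<Rightarrow> (nat monomial) cpoly"
  where "apolar_functional n d j u v = (\<Sum>s\<le>n. \<Sum>t\<le>n.
    (let m = Poly_Mapping.single j (d - 2) + Poly_Mapping.single s 1 + Poly_Mapping.single t 1
     in Poly_Mapping.single (Poly_Mapping.single m 1) (u s * v t / of_nat (multinomial n d m))))"

text \<open>Up to a scalar factor, the matrix is the Hessian of \<open>\<partial>\<^sub>j\<^sup>d\<^sup>-\<^sup>2 F\<close>, restricted to the span of
  the vectors \<open>g 0, \<dots>, g k\<close>. Arbitrary vectors are allowed, rather than coordinate vectors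
  only, so that \<open>g\<close> can be taken dual to a given set of linear forms.\<close>

definition minor :: "nat \<Rightarrow> nat \<Rightarrow> nat \<Rightarrow> nat \<Rightarrow> (nat \<Rightarrow> nat \<Rightarrow> complex) \<Rightarrow> (nat monomial) cpoly"
  where "minor n d j k g = det (mat (Suc k) (Suc k) (\<lambda>(p, q). apolar_functional n d j (g p) (g q)))"

lemma apolar_monomial:
  assumes "j \<le> n" "s \<le> n" "t \<le> n" "2 \<le> d"
  shows "Poly_Mapping.single j (d - 2) + Poly_Mapping.single s 1 + Poly_Mapping.single t 1 \<in> monomials {..n} d"
  using assms
    keys_add[of "Poly_Mapping.single j (d - 2) + Poly_Mapping.single s 1" "Poly_Mapping.single t 1"]
    keys_add[of "Poly_Mapping.single j (d - 2)" "Poly_Mapping.single s (1::nat)"]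
  by (auto simp: monomials_def mdeg_add split: if_splits)

lemma apolar_functional_in_forms:
  assumes "j \<le> n" "2 \<le> d"
  shows "apolar_functional n d j u v \<in> forms (monomials {..n} d) 1"
  unfolding apolar_functional_def Let_def
proof (intro forms_sum, goal_cases)
  case (1 s t)
  then show ?case
    using apolar_monomial[OF assms(1) _ _ assms(2), of s t]
    by (auto simp: forms_def monomials_def[of "monomials {..n} d"] split: if_splits)
qed

lemma minor_in_forms:
  assumes "j \<le> n" "2 \<le> d"
  shows "minor n d j k g \<in> forms (monomials {..n} d) (Suc k)"
proof -
  let ?M = "mat (Suc k) (Suc k) (\<lambda>(p, q). apolar_functional n d j (g p) (g q))"
  have "minor n d j k g =
      (\<Sum>p | p permutes {0..<Suc k}. signof p * (\<Prod>i = 0..<Suc k. ?M $$ (i, p i)))"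
    unfolding minor_def by (simp add: det_def)
  moreover have "signof p * (\<Prod>i = 0..<Suc k. ?M $$ (i, p i)) \<in> forms (monomials {..n} d) (Suc k)"
    if "p permutes {0..<Suc k}" for p
  proof -
    have "?M $$ (i, p i) \<in> forms (monomials {..n} d) 1" if "i \<in> {0..<Suc k}" for i
      using that permutes_in_image[OF \<open>p permutes {0..<Suc k}\<close>, of i]
        apolar_functional_in_forms[OF assms] by simp
    then have "(\<Prod>i = 0..<Suc k. ?M $$ (i, p i)) \<in> forms (monomials {..n} d) (1 * card {0..<Suc k})"
      by (intro forms_prod) auto
    moreover have "(signof p :: (nat monomial) cpoly) \<in> forms (monomials {..n} d) 0"
      using forms_const[of 1] forms_const[of "-1"] by (auto simp: sign_def single_uminus)
    ultimately show ?thesis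
      using forms_mult by fastforce
  qed
  ultimately show ?thesis
    by (auto intro: forms_sum)
qed

lemma apolar_functional_power_sum:
  assumes "j \<le> n" "2 \<le> d"
  shows "poly_eval (coeff (\<Sum>i\<in>K. linear_form n (L i) ^ d)) (apolar_functional n d j u v) =
    (\<Sum>i\<in>K. L i j ^ (d - 2) * (\<Sum>s\<le>n. u s * L i s) * (\<Sum>t\<le>n. v t * L i t))"
proof -
  define mon where "mon s t = Poly_Mapping.single j (d - 2) + Poly_Mapping.single s 1 + Poly_Mapping.single t (1::nat)" for s t
  have nz: "multinomial n d (mon s t) \<noteq> 0" if "s \<le> n" "t \<le> n" for s t
    using multinomial_pos[OF apolar_monomial[OF assms(1) that assms(2)]] by (simp add: mon_def)
  have mon: "monomial_eval a (mon s t) = a j ^ (d - 2) * a s * a t" for a s t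
  proof -
    have "monomial_eval a (Poly_Mapping.single i c) = a i ^ c" for i c
      by (cases "c = 0") (simp_all add: monomial_eval_def)
    then show ?thesis
      by (simp add: mon_def monomial_eval_add)
  qed
  have "poly_eval (coeff (\<Sum>i\<in>K. linear_form n (L i) ^ d)) (apolar_functional n d j u v) =
      (\<Sum>s\<le>n. \<Sum>t\<le>n. u s * v t / of_nat (multinomial n d (mon s t)) *
        (\<Sum>i\<in>K. of_nat (multinomial n d (mon s t)) * (L i j ^ (d - 2) * L i s * L i t)))"
    unfolding apolar_functional_def Let_def mon_def[symmetric] mon[symmetric]
    by (simp add: poly_eval_sum poly_eval_single monomial_eval_def[of _ "Poly_Mapping.single _ _"]
      lookup_sum coeff_linear_form_power)
  also have "\<dots> = (\<Sum>s\<le>n. \<Sum>t\<le>n. \<Sum>i\<in>K. L i j ^ (d - 2) * (u s * L i s) * (v t * L i t))"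
    by (intro sum.cong refl) (simp add: sum_distrib_left nz mult_ac)
  also have "\<dots> = (\<Sum>i\<in>K. \<Sum>s\<le>n. \<Sum>t\<le>n. L i j ^ (d - 2) * (u s * L i s) * (v t * L i t))"
    by (subst sum.swap[of _ K], subst sum.swap[of _ _ K]) (rule refl)
  also have "\<dots> = (\<Sum>i\<in>K. L i j ^ (d - 2) * (\<Sum>s\<le>n. u s * L i s) * (\<Sum>t\<le>n. v t * L i t))"
    by (simp add: sum_distrib_left sum_distrib_right mult_ac)
  finally show ?thesis .
qed

text \<open>On \<open>F = L\<^sub>0\<^sup>d + \<dots> + L\<^sub>k\<^sup>d\<close> the matrix factors as \<open>A D A\<^sup>T\<close> with
  \<open>A\<^sub>p\<^sub>i = g\<^sub>p \<bullet> L\<^sub>i\<close> and \<open>D\<close> diagonal with entries \<open>(L\<^sub>i)\<^sub>j\<^sup>d\<^sup>-\<^sup>2\<close>. The minor therefore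
  detects two things at once: whether the \<open>L\<^sub>i\<close> are independent and whether the \<open>j\<close>-th
  coordinate of one of them vanishes.\<close>

lemma minor_power_sum:
  assumes "j \<le> n" "2 \<le> d"
  shows "poly_eval (coeff (\<Sum>i\<le>k. linear_form n (L i) ^ d)) (minor n d j k g) =
    det (mat (Suc k) (Suc k) (\<lambda>(p, i). \<Sum>s\<le>n. g p s * L i s)) ^ 2 * (\<Prod>i\<le>k. L i j ^ (d - 2))"
proof -
  let ?x = "coeff (\<Sum>i\<le>k. linear_form n (L i) ^ d)"
  interpret hom: comm_ring_hom "poly_eval ?x"
    by unfold_locales (simp_all add: poly_eval_zero poly_eval_one poly_eval_add poly_eval_mult)
  define A where "A = mat (Suc k) (Suc k) (\<lambda>(p, i). \<Sum>s\<le>n. g p s * L i s)"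
  define B where "B = mat (Suc k) (Suc k) (\<lambda>(i, q). L i j ^ (d - 2) * (\<Sum>s\<le>n. g q s * L i s))"
  define D where "D = mat (Suc k) (Suc k) (\<lambda>(i, q). if i = q then L i j ^ (d - 2) else 0)"
  have [simp]: "A \<in> carrier_mat (Suc k) (Suc k)" "B \<in> carrier_mat (Suc k) (Suc k)"
      "D \<in> carrier_mat (Suc k) (Suc k)" "A\<^sup>T \<in> carrier_mat (Suc k) (Suc k)"
    by (simp_all add: A_def B_def D_def)
  have B: "B = D * A\<^sup>T"
    by (rule eq_matI) (simp_all add: A_def B_def D_def scalar_prod_def if_distrib if_distribR cong: if_cong)
  have "map_mat (poly_eval ?x) (mat (Suc k) (Suc k) (\<lambda>(p, q). apolar_functional n d j (g p) (g q))) = A * B"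
    by (rule eq_matI)
      (simp_all add: apolar_functional_power_sum[OF assms] A_def B_def scalar_prod_def
        atLeast0LessThan lessThan_Suc_atMost mult_ac)
  then have "poly_eval ?x (minor n d j k g) = det (A * B)"
    by (simp add: minor_def flip: hom.hom_det)
  also have "\<dots> = det A * (det D * det A)"
    using det_mult[of A "Suc k" "D * A\<^sup>T"] det_mult[of D "Suc k" "A\<^sup>T"]
      det_transpose[of A "Suc k"] mult_carrier_mat[of D "Suc k" "Suc k" "A\<^sup>T" "Suc k"]
    by (simp add: B)
  also have "det D = (\<Prod>i\<le>k. L i j ^ (d - 2))"
  proof -
    have "det D = prod_list (diag_mat D)"
      by (rule det_upper_triangular[of _ "Suc k"]) (auto simp: D_def)
    also have "diag_mat D = map (\<lambda>i. L i j ^ (d - 2)) [0..<Suc k]"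
      by (auto simp: diag_mat_def D_def)
    finally show ?thesis
      by (metis atLeastLessThanSuc_atLeastAtMost atMost_atLeast0 interv_sum_list_conv_sum_set_nat
        prod.set_conv_list set_upt distinct_upt prod.distinct_set_conv_list)
  qed
  finally show ?thesis
    by (simp add: A_def power2_eq_square mult_ac)
qed


section \<open>Irreducible cones\<close>

definition polynomial_function :: "(complex \<Rightarrow> complex) \<Rightarrow> bool"
  where "polynomial_function f \<longleftrightarrow> (\<exists>p. \<forall>u. f u = poly p u)"

lemma polynomial_function_const: "polynomial_function (\<lambda>u. c)"
  unfolding polynomial_function_def by (rule exI[of _ "[:c:]"]) simp

lemma polynomial_function_id: "polynomial_function (\<lambda>u. u)"
  unfolding polynomial_function_def by (rule exI[of _ "[:0, 1:]"]) simp

lemma polynomial_function_add: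
  "polynomial_function f \<Longrightarrow> polynomial_function g \<Longrightarrow> polynomial_function (\<lambda>u. f u + g u)"
  unfolding polynomial_function_def by (metis poly_add)

lemma polynomial_function_mult:
  "polynomial_function f \<Longrightarrow> polynomial_function g \<Longrightarrow> polynomial_function (\<lambda>u. f u * g u)"
  unfolding polynomial_function_def by (metis poly_mult)

lemma polynomial_function_minus: "polynomial_function f \<Longrightarrow> polynomial_function (\<lambda>u. - f u)"
  unfolding polynomial_function_def by (metis poly_minus)

lemma polynomial_function_power: "polynomial_function f \<Longrightarrow> polynomial_function (\<lambda>u. f u ^ k)"
  unfolding polynomial_function_def by (metis poly_power)

lemma polynomial_function_sum:
  "(\<And>i. i \<in> A \<Longrightarrow> polynomial_function (f i)) \<Longrightarrow> polynomial_function (\<lambda>u. \<Sum>i\<in>A. f i u)"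
  by (induction A rule: infinite_finite_induct)
    (auto intro: polynomial_function_const polynomial_function_add)

lemma polynomial_function_prod:
  "(\<And>i. i \<in> A \<Longrightarrow> polynomial_function (f i)) \<Longrightarrow> polynomial_function (\<lambda>u. \<Prod>i\<in>A. f i u)"
  by (induction A rule: infinite_finite_induct)
    (auto intro: polynomial_function_const polynomial_function_mult)

lemmas polynomial_function_intros =
  polynomial_function_const polynomial_function_id polynomial_function_add polynomial_function_mult
  polynomial_function_minus polynomial_function_power polynomial_function_sum polynomial_function_prod

lemma polynomial_function_mult_nonzero:
  assumes "polynomial_function f" "polynomial_function g" "f a \<noteq> 0" "g b \<noteq> 0"
  shows "\<exists>u. f u \<noteq> 0 \<and> g u \<noteq> 0"
proof -
  obtain p q where pq: "\<And>u. f u = poly p u" "\<And>u. g u = poly q u"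
    using assms(1,2) unfolding polynomial_function_def by blast
  have "p * q \<noteq> 0"
    using assms(3,4) pq by auto
  then obtain u where "poly (p * q) u \<noteq> 0"
    using poly_all_0_iff_0 by blast
  then show ?thesis
    using pq by auto
qed

text \<open>This replaces the irreducibility of an affine parameter space. Two polynomials that are
  nonzero somewhere on the set pull back to nonzero polynomials in one variable on a suitable
  curve, and so have a common point of the set where neither vanishes. Only univariate
  polynomials are involved.\<close>

definition joined_by_curves :: "'x cpoly set \<Rightarrow> bool"
  where "joined_by_curves C \<longleftrightarrow> (\<forall>F\<in>C. \<forall>G\<in>C. \<exists>\<gamma>. \<gamma> 0 = F \<and> \<gamma> 1 = G \<and> range \<gamma> \<subseteq> C \<and>
    (\<forall>m. polynomial_function (\<lambda>u. coeff (\<gamma> u) m)))"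

lemma poly_eval_variable: "poly_eval x (Poly_Mapping.single (Poly_Mapping.single m 1) 1) = x m"
  by (simp add: poly_eval_single monomial_eval_def)

lemma joined_by_curves_common_nonzero:
  assumes C: "joined_by_curves C" and F: "F\<^sub>1 \<in> C" "F\<^sub>2 \<in> C" "F\<^sub>1 \<noteq> 0"
    and nz: "poly_eval (coeff F\<^sub>1) P \<noteq> 0" "poly_eval (coeff F\<^sub>2) Q \<noteq> 0"
  obtains F where "F \<in> C" "F \<noteq> 0" "poly_eval (coeff F) P \<noteq> 0" "poly_eval (coeff F) Q \<noteq> 0"
proof -
  obtain \<gamma> where \<gamma>: "\<gamma> 0 = F\<^sub>1" "\<gamma> 1 = F\<^sub>2" "range \<gamma> \<subseteq> C"
      "\<And>m. polynomial_function (\<lambda>u. coeff (\<gamma> u) m)"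
    using C F unfolding joined_by_curves_def by blast
  \<comment> \<open>Multiplying \<open>P\<close> by a coordinate that is nonzero at \<open>F\<^sub>1\<close> keeps the common point away from \<open>0\<close>.\<close>
  obtain m where "coeff F\<^sub>1 m \<noteq> 0"
    using F(3) by (metis poly_mapping_eqI lookup_zero)
  then have 0: "poly_eval (coeff F\<^sub>1) (P * Poly_Mapping.single (Poly_Mapping.single m 1) 1) \<noteq> 0"
    using nz(1) by (simp add: poly_eval_mult poly_eval_variable[simplified])
  have poly: "polynomial_function (\<lambda>u. poly_eval (coeff (\<gamma> u)) H)" for H
    unfolding poly_eval_def monomial_eval_def by (intro polynomial_function_intros \<gamma>(4))
  then obtain u where
      "poly_eval (coeff (\<gamma> u)) (P * Poly_Mapping.single (Poly_Mapping.single m 1) 1) \<noteq> 0"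
      "poly_eval (coeff (\<gamma> u)) Q \<noteq> 0"
    using polynomial_function_mult_nonzero[OF poly poly, where a = 0 and b = 1] 0 nz(2)
    unfolding \<gamma>(1,2) by blast
  moreover from this have "\<gamma> u \<noteq> 0"
    by (auto simp: poly_eval_mult poly_eval_variable[simplified])
  ultimately show ?thesis
    using that[of "\<gamma> u"] \<gamma>(3) by (auto simp: poly_eval_mult)
qed

text \<open>The equations are those of a set of points of projective space, and an element \<open>0\<close> of \<open>C\<close>
  represents no such point.\<close>

definition vanishing_forms :: "nat \<Rightarrow> nat \<Rightarrow> nat cpoly set \<Rightarrow> (nat monomial) cpoly set"
  where "vanishing_forms n d C =
    {H \<in> coord_forms n d. \<forall>F\<in>C. F \<noteq> 0 \<longrightarrow> poly_eval (coeff F) H = 0}"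

text \<open>The Zariski closure of the set of points of projective space represented by \<open>C\<close>.\<close>

definition cone_closure :: "nat \<Rightarrow> nat \<Rightarrow> nat cpoly set \<Rightarrow> nat cpoly set set"
  where "cone_closure n d C = zero_locus n d (vanishing_forms n d C)"

lemma vanishing_forms_subset: "vanishing_forms n d C \<subseteq> coord_forms n d"
  by (auto simp: vanishing_forms_def)

lemma closedin_cone_closure: "closedin (zariski n d) (cone_closure n d C)"
  unfolding closedin_zariski_iff zariski_closed_def cone_closure_def
  using vanishing_forms_subset by blast

lemma pt_in_cone_closure:
  assumes "F \<in> C" "F \<in> forms {..n} d" "F \<noteq> 0"
  shows "pt F \<in> cone_closure n d C"
  using assms unfolding cone_closure_def zero_locus_def vanishing_forms_def by blast

lemma cone_closure_minimal:
  assumes "C \<subseteq> forms {..n} d" "closedin (zariski n d) Z"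
    and "\<And>F. F \<in> C \<Longrightarrow> F \<noteq> 0 \<Longrightarrow> pt F \<in> Z"
  shows "cone_closure n d C \<subseteq> Z"
proof -
  obtain S where S: "S \<subseteq> coord_forms n d" "Z = zero_locus n d S"
    using assms(2) unfolding closedin_zariski_iff zariski_closed_def by blast
  have "poly_eval (coeff F) H = 0" if "F \<in> C" "F \<noteq> 0" "H \<in> S" for F H
    using assms(1,3) that pt_in_zero_locus_iff[OF _ _ S(1)] S(2) by blast
  then have "S \<subseteq> vanishing_forms n d C"
    using S(1) by (auto simp: vanishing_forms_def)
  then show ?thesis
    unfolding cone_closure_def S(2) zero_locus_def by blast
qed

lemma cone_closure_mono:
  assumes "C \<subseteq> C'"
  shows "cone_closure n d C \<subseteq> cone_closure n d C'"
  using assms unfolding cone_closure_def zero_locus_def vanishing_forms_def by blast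

text \<open>An equation of \<open>Z\<close> that failed at some element of \<open>C\<close> would also fail at an element where
  \<open>G\<close> is nonzero. Hence a condition that holds for generic parameters only is enough to place the
  whole closure inside \<open>Z\<close>.\<close>

lemma cone_closure_generic_subset:
  assumes C: "joined_by_curves C" "C \<subseteq> forms {..n} d" and Z: "closedin (zariski n d) Z"
    and W: "W \<in> C" "W \<noteq> 0" "poly_eval (coeff W) G \<noteq> 0"
    and *: "\<And>F. F \<in> C \<Longrightarrow> F \<noteq> 0 \<Longrightarrow> poly_eval (coeff F) G \<noteq> 0 \<Longrightarrow> pt F \<in> Z"
  shows "cone_closure n d C \<subseteq> Z"
proof (rule cone_closure_minimal[OF C(2) Z])
  fix F
  assume F: "F \<in> C" "F \<noteq> 0"
  obtain S where S: "S \<subseteq> coord_forms n d" "Z = zero_locus n d S"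
    using Z unfolding closedin_zariski_iff zariski_closed_def by blast
  have mem: "pt F' \<in> Z \<longleftrightarrow> (\<forall>H\<in>S. poly_eval (coeff F') H = 0)" if "F' \<in> C" "F' \<noteq> 0" for F'
    using pt_in_zero_locus_iff[of F' n d S] that C(2) S by blast
  show "pt F \<in> Z"
  proof (rule ccontr)
    assume "pt F \<notin> Z"
    then obtain H where H: "H \<in> S" "poly_eval (coeff F) H \<noteq> 0"
      using mem[OF F] by blast
    obtain F' where "F' \<in> C" "F' \<noteq> 0" "poly_eval (coeff F') G \<noteq> 0" "poly_eval (coeff F') H \<noteq> 0"
      using joined_by_curves_common_nonzero[OF C(1) W(1) F(1) W(2,3) H(2)] .
    then show False
      using * mem H(1) by blast
  qed
qed

text \<open>If the closure is covered by two closed sets neither of which contains it, each has an equation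
  that fails somewhere on \<open>C\<close>. The two equations fail simultaneously at some element of \<open>C\<close>, whose
  point lies in neither set.\<close>

lemma irreducible_cone_closure:
  assumes C: "joined_by_curves C" "C \<subseteq> forms {..n} d" and W: "W \<in> C" "W \<noteq> 0"
  shows "irreducible_closedin (zariski n d) (cone_closure n d C)"
  unfolding irreducible_closedin_def
proof (intro conjI allI impI)
  show "closedin (zariski n d) (cone_closure n d C)"
    by (rule closedin_cone_closure)
  show "cone_closure n d C \<noteq> {}"
    using pt_in_cone_closure[of W C n d] W C(2) by blast
next
  fix A B
  assume *: "closedin (zariski n d) A \<and> closedin (zariski n d) B \<and> cone_closure n d C = A \<union> B"
  then obtain S T where S: "S \<subseteq> coord_forms n d" "A = zero_locus n d S"
      and T: "T \<subseteq> coord_forms n d" "B = zero_locus n d T"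
    unfolding closedin_zariski_iff zariski_closed_def by blast
  have memA: "pt F \<in> A \<longleftrightarrow> (\<forall>H\<in>S. poly_eval (coeff F) H = 0)"
    and memB: "pt F \<in> B \<longleftrightarrow> (\<forall>H\<in>T. poly_eval (coeff F) H = 0)" if "F \<in> C" "F \<noteq> 0" for F
    using pt_in_zero_locus_iff[of F n d] that C(2) S T by blast+
  show "cone_closure n d C = A \<or> cone_closure n d C = B"
  proof (rule ccontr)
    assume "\<not> ?thesis"
    then have "\<not> cone_closure n d C \<subseteq> A" "\<not> cone_closure n d C \<subseteq> B"
      using * by blast+
    then obtain F\<^sub>1 F\<^sub>2 where F: "F\<^sub>1 \<in> C" "F\<^sub>1 \<noteq> 0" "pt F\<^sub>1 \<notin> A" "F\<^sub>2 \<in> C" "F\<^sub>2 \<noteq> 0" "pt F\<^sub>2 \<notin> B"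
      using cone_closure_minimal[OF C(2)] * by metis
    then obtain P Q where PQ: "P \<in> S" "poly_eval (coeff F\<^sub>1) P \<noteq> 0" "Q \<in> T" "poly_eval (coeff F\<^sub>2) Q \<noteq> 0"
      using memA memB by metis
    obtain F where F': "F \<in> C" "F \<noteq> 0" "poly_eval (coeff F) P \<noteq> 0" "poly_eval (coeff F) Q \<noteq> 0"
      using joined_by_curves_common_nonzero[OF C(1) F(1,4,2) PQ(2,4)] .
    then have "pt F \<in> A \<union> B"
      using pt_in_cone_closure[of F C n d] C(2) * by blast
    then show False
      using F' PQ memA memB by blast
  qed
qed

lemma irreducible_closedin_subtopology:
  assumes "closedin X S" "Z \<subseteq> S" "irreducible_closedin X Z"
  shows "irreducible_closedin (subtopology X S) Z"
  using assms by (auto simp: irreducible_closedin_def closedin_closed_subtopology)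

lemma krull_dim_ge:
  fixes Z :: "nat \<Rightarrow> 'a set"
  assumes "\<And>i. i \<le> m \<Longrightarrow> irreducible_closedin X (Z i)" "\<And>i. i < m \<Longrightarrow> Z i \<subset> Z (Suc i)"
  shows "krull_dim X \<ge> enat m"
  unfolding krull_dim_def by (rule Sup_upper) (use assms in blast)


section \<open>Power sums with a distinguished eigenvector\<close>

text \<open>The coefficient vectors of the linear forms: \<open>L\<^sub>0 = (1, a)\<close> with \<open>a = t 0\<close>, and
  \<open>L\<^sub>i = (- b\<^sub>i \<bullet> a, b\<^sub>i)\<close> with \<open>b\<^sub>i = t i\<close> for \<open>i > 0\<close>. The first coordinate of \<open>L\<^sub>i\<close> is the
  one that makes it orthogonal to \<open>L\<^sub>0\<close>.\<close>

definition eigen_config :: "nat \<Rightarrow> (nat \<Rightarrow> nat \<Rightarrow> complex) \<Rightarrow> nat \<Rightarrow> nat \<Rightarrow> complex"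
  where "eigen_config n t i l =
    (if l = 0 then if i = 0 then 1 else - (\<Sum>j=1..n. t i j * t 0 j) else t i l)"

definition eigen_form :: "nat \<Rightarrow> nat \<Rightarrow> nat \<Rightarrow> (nat \<Rightarrow> nat \<Rightarrow> complex) \<Rightarrow> nat cpoly"
  where "eigen_form n r d t = (\<Sum>i\<le>r. linear_form n (eigen_config n t i) ^ d)"

text \<open>The parameters \<open>t i l\<close> with \<open>1 \<le> l \<le> n\<close> are numbered \<open>i n + l\<close>: first the coordinates of
  \<open>L\<^sub>0\<close>, then those of \<open>L\<^sub>1\<close>, and so on. All parameters after the \<open>s\<close>-th one are zero.\<close>

definition first_parameters :: "nat \<Rightarrow> nat \<Rightarrow> (nat \<Rightarrow> nat \<Rightarrow> complex) set"
  where "first_parameters n s = {t. \<forall>i. \<forall>l\<in>{1..n}. s < i * n + l \<longrightarrow> t i l = 0}"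

lemma eigen_form_in_forms: "eigen_form n r d t \<in> forms {..n} d"
  unfolding eigen_form_def by (intro forms_sum linear_form_power_in_forms)

lemma atMost_eq_insert_0: "{..n} = insert 0 {1..n::nat}"
  by auto

lemma eigen_config_orthogonal:
  assumes "i \<noteq> 0"
  shows "(\<Sum>l\<le>n. eigen_config n t i l * eigen_config n t 0 l) = 0"
proof -
  have "(\<Sum>l=1..n. eigen_config n t i l * eigen_config n t 0 l) = (\<Sum>l=1..n. t i l * t 0 l)"
    by (intro sum.cong) (auto simp: eigen_config_def)
  then show ?thesis
    using assms by (simp add: atMost_eq_insert_0) (simp add: eigen_config_def)
qed

lemma linear_form_zero: "(\<And>l. l \<le> n \<Longrightarrow> a l = 0) \<Longrightarrow> linear_form n a = 0"
  by (simp add: linear_form_def)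

lemma eigen_form_truncate:
  assumes t: "t \<in> first_parameters n s" and "s \<le> Suc k * n" "k \<le> r" "d > 0"
  shows "eigen_form n r d t = eigen_form n k d t"
proof -
  have "linear_form n (eigen_config n t i) ^ d = 0" if "i \<in> {..r} - {..k}" for i
  proof -
    have "t i l = 0" if "l \<in> {1..n}" for l
    proof -
      have "Suc k * n \<le> i * n"
        using \<open>i \<in> {..r} - {..k}\<close> by (intro mult_le_mono1) auto
      then have "s < i * n + l"
        using assms(2) that by simp
      then show ?thesis
        using t that by (simp add: first_parameters_def)
    qed
    then have "linear_form n (eigen_config n t i) = 0"
      using that by (intro linear_form_zero) (auto simp: eigen_config_def)
    then show ?thesis
      using \<open>d > 0\<close> by simp
  qed
  then show ?thesis
    unfolding eigen_form_def using \<open>k \<le> r\<close> by (intro sum.mono_neutral_right) auto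
qed

text \<open>A straight line in parameter space is mapped to a polynomial curve of forms.\<close>

lemma joined_by_curves_eigen_forms:
  "joined_by_curves (eigen_form n r d ` first_parameters n s)"
  unfolding joined_by_curves_def
proof (intro ballI)
  fix F G
  assume "F \<in> eigen_form n r d ` first_parameters n s" "G \<in> eigen_form n r d ` first_parameters n s"
  then obtain t t' where t: "t \<in> first_parameters n s" "F = eigen_form n r d t"
      "t' \<in> first_parameters n s" "G = eigen_form n r d t'"
    by blast
  define \<tau> where "\<tau> u i l = (1 + - u) * t i l + u * t' i l" for u i l
  have \<tau>: "\<tau> 0 = t" "\<tau> 1 = t'" "\<tau> u \<in> first_parameters n s" for u
    using t by (auto simp: \<tau>_def first_parameters_def fun_eq_iff)
  have "polynomial_function (\<lambda>u. eigen_config n (\<tau> u) i l)" for i l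
    unfolding eigen_config_def \<tau>_def
    by (cases "l = 0"; cases "i = 0"; simp only: if_True if_False simp_thms)
      (intro polynomial_function_intros)+
  then have "polynomial_function (\<lambda>u. coeff (eigen_form n r d (\<tau> u)) m)" for m
    unfolding eigen_form_def lookup_sum coeff_linear_form_power monomial_eval_def
    by (intro polynomial_function_intros)
  then show "\<exists>\<gamma>. \<gamma> 0 = F \<and> \<gamma> 1 = G \<and> range \<gamma> \<subseteq> eigen_form n r d ` first_parameters n s \<and>
      (\<forall>m. polynomial_function (\<lambda>u. coeff (\<gamma> u) m))"
    using t \<tau> by (intro exI[of _ "\<lambda>u. eigen_form n r d (\<tau> u)"]) auto
qed


section \<open>A configuration with nonvanishing minor\<close>

text \<open>The witness for the minors: forms \<open>L\<^sub>0, \<dots>, L\<^sub>k\<close> with nonzero \<open>j\<close>-th coordinate, only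
  the first \<open>k n + j\<close> parameters being used, together with a dual family \<open>g\<close>. For \<open>k > 0\<close> it has
  \<open>L\<^sub>0 = (1, \<dots>, 1)\<close>, \<open>b\<^sub>i = e\<^sub>j + e\<^sub>\<sigma>\<^sub>(\<^sub>i\<^sub>)\<close> for \<open>0 < i < k\<close>, and \<open>b\<^sub>k = e\<^sub>j\<close>, where \<open>\<sigma>\<close> enumerates
  the indices from \<open>1\<close> other than \<open>j\<close>; the bound \<open>k \<le> n\<close> ensures that there are enough of them.
  For \<open>k = 0\<close> the vector \<open>L\<^sub>0\<close> itself stops at its \<open>j\<close>-th coordinate.\<close>

lemma exists_config_with_minor:
  assumes j: "1 \<le> j" "j \<le> n" and "k \<le> n"
  shows "\<exists>t\<in>first_parameters n (k * n + j). \<exists>g.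
    mat (Suc k) (Suc k) (\<lambda>(p, i). \<Sum>s\<le>n. g p s * eigen_config n t i s) = 1\<^sub>m (Suc k) \<and>
    (\<forall>i\<le>k. eigen_config n t i j \<noteq> 0)"
proof (cases "k = 0")
  case True
  define t :: "nat \<Rightarrow> nat \<Rightarrow> complex" where "t i l = (if i = 0 \<and> l \<le> j then 1 else 0)" for i l
  define g :: "nat \<Rightarrow> nat \<Rightarrow> complex" where "g p s = (if s = 0 then 1 else 0)" for p s
  have "(\<Sum>s\<le>n. g p s * a s) = a 0" for p a
    by (subst sum.remove[of _ 0]) (auto simp: g_def intro!: sum.neutral)
  then have "mat (Suc k) (Suc k) (\<lambda>(p, i). \<Sum>s\<le>n. g p s * eigen_config n t i s) = 1\<^sub>m (Suc k)"
    using True by (intro eq_matI) (auto simp: eigen_config_def)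
  moreover have "t \<in> first_parameters n (k * n + j)"
    using True by (auto simp: first_parameters_def t_def)
  moreover have "\<forall>i\<le>k. eigen_config n t i j \<noteq> 0"
    using True j by (simp add: eigen_config_def t_def)
  ultimately show ?thesis
    by blast
next
  case False
  define \<sigma> where "\<sigma> i = (if i < j then i else Suc i)" for i
  have \<sigma>: "\<sigma> i \<noteq> j" "\<sigma> i = \<sigma> i' \<longleftrightarrow> i = i'" for i i'
    by (auto simp: \<sigma>_def)
  have \<sigma>_range: "\<sigma> i \<in> {1..n}" if "1 \<le> i" "i < k" for i
    using that \<open>k \<le> n\<close> by (auto simp: \<sigma>_def)
  define t :: "nat \<Rightarrow> nat \<Rightarrow> complex" where
    "t i l = (if i = 0 then 1 else if i < k then of_bool (l = j) + of_bool (l = \<sigma> i)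
      else if i = k then of_bool (l = j) else 0)" for i l
  let ?L = "eigen_config n t"
  define c :: complex where "c = 1 / of_nat (Suc n)"
  define g :: "nat \<Rightarrow> nat \<Rightarrow> complex" where
    "g p s = (if p = 0 then c else if p < k then of_bool (s = \<sigma> p) - c
      else of_bool (s = j) - (\<Sum>i=1..<k. of_bool (s = \<sigma> i)) + (of_nat k - 2) * c)" for p s
  have pick: "(\<Sum>s\<le>n. of_bool (s = l) * a s) = a l" if "l \<le> n" for l and a :: "nat \<Rightarrow> complex"
    using that by (subst sum.remove[of _ l]) (auto intro!: sum.neutral)
  have L0: "?L 0 l = 1" for l
    by (simp add: eigen_config_def t_def)
  \<comment> \<open>Every other \<open>L\<^sub>i\<close> is orthogonal to \<open>L\<^sub>0 = (1, \<dots>, 1)\<close>, so the sum of the coordinates,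
    divided by \<open>n + 1\<close>, is dual to \<open>L\<^sub>0\<close>. The remaining functionals read off the coordinates
    \<open>\<sigma> p\<close> and \<open>j\<close>, corrected by multiples of this one.\<close>
  have total: "c * (\<Sum>s\<le>n. ?L i s) = of_bool (i = 0)" for i
    using eigen_config_orthogonal[of i n t] by (cases "i = 0") (simp_all add: L0 c_def del: of_nat_Suc)
  have Lj: "?L i j = 1" if "i \<le> k" for i
    using that j \<sigma>(1)[of i] by (auto simp: eigen_config_def t_def)
  have L\<sigma>: "?L i (\<sigma> p) = of_bool (i = 0 \<or> i = p)" if "i \<le> k" "1 \<le> p" "p < k" for i p
    using that \<sigma>(1)[of p] \<sigma>_range[of p] by (auto simp: eigen_config_def t_def \<sigma>(2))
  have dual: "(\<Sum>s\<le>n. g p s * ?L i s) = of_bool (p = i)" if pi: "p \<le> k" "i \<le> k" for p i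
  proof -
    consider "p = 0" | "1 \<le> p" "p < k" | "p = k"
      using pi by linarith
    then show ?thesis
    proof cases
      case 1
      then show ?thesis
        using total[of i] by (simp add: g_def sum_distrib_left)
    next
      case 2
      have "(\<Sum>s\<le>n. g p s * ?L i s) = ?L i (\<sigma> p) - c * (\<Sum>s\<le>n. ?L i s)"
        using 2 \<sigma>_range[OF 2] pick[of "\<sigma> p" "?L i"]
        by (simp add: g_def left_diff_distrib sum_subtractf sum_distrib_left)
      then show ?thesis
        unfolding total using L\<sigma>[OF pi(2) 2] 2 by auto
    next
      case 3
      have "(\<Sum>s\<le>n. (\<Sum>q=1..<k. of_bool (s = \<sigma> q)) * ?L i s) = (\<Sum>q=1..<k. ?L i (\<sigma> q))"
        unfolding sum_distrib_right
        by (subst sum.swap) (use \<sigma>_range pick in \<open>auto intro!: sum.cong\<close>)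
      also have "\<dots> = (\<Sum>q=1..<k. of_bool (i = 0 \<or> i = q))"
        using L\<sigma>[OF pi(2)] by (intro sum.cong) auto
      also have "\<dots> = (if i = 0 then of_nat k - 1 else of_bool (i < k))"
        using False by (auto simp: of_bool_def of_nat_diff)
      finally have \<sigma>_sum: "(\<Sum>s\<le>n. (\<Sum>q=1..<k. of_bool (s = \<sigma> q)) * ?L i s) =
          (if i = 0 then of_nat k - 1 else of_bool (i < k))" .
      have "(\<Sum>s\<le>n. g p s * ?L i s) = ?L i j - (if i = 0 then of_nat k - 1 else of_bool (i < k))
          + (of_nat k - 2) * (c * (\<Sum>s\<le>n. ?L i s))"
        using 3 False j pick[of j "?L i"] \<sigma>_sum
        by (simp add: g_def left_diff_distrib distrib_right sum.distrib sum_subtractf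
          sum_distrib_left mult.assoc)
      then show ?thesis
        unfolding total Lj[OF pi(2)] using 3 False pi by auto
    qed
  qed
  have "mat (Suc k) (Suc k) (\<lambda>(p, i). \<Sum>s\<le>n. g p s * ?L i s) = 1\<^sub>m (Suc k)"
    by (rule eq_matI) (auto simp: dual)
  moreover have "t \<in> first_parameters n (k * n + j)"
    unfolding first_parameters_def
  proof (intro CollectI allI ballI impI)
    fix i l
    assume l: "l \<in> {1..n}" "k * n + j < i * n + l"
    show "t i l = 0"
    proof (cases "i < k")
      case True
      then have "Suc i * n \<le> k * n"
        by (intro mult_le_mono1) simp
      then show ?thesis
        using l by simp
    next
      case False
      then show ?thesis
        using l \<open>k \<noteq> 0\<close> by (auto simp: t_def)
    qed
  qed
  moreover have "\<forall>i\<le>k. ?L i j \<noteq> 0"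
    by (simp add: Lj)
  ultimately show ?thesis
    by blast
qed


section \<open>Membership in the critical Waring variety\<close>

text \<open>A decomposition with fewer than \<open>r + 1\<close> summands can be padded with zero linear forms. One of
  the \<open>j\<close>-th coordinates is then \<open>0\<close>, and the product formula makes the minor vanish.\<close>

lemma waring_rank_eqI:
  assumes F: "F = (\<Sum>i\<le>r. linear_form n (L i) ^ d)" and "j \<le> n" "3 \<le> d"
    and nz: "poly_eval (coeff F) (minor n d j r g) \<noteq> 0"
  shows "waring_rank n d F = Suc r"
  unfolding waring_rank_def
proof (rule Least_equality)
  show "\<exists>M. (\<forall>i\<in>{1..Suc r}. M i \<in> forms {..n} 1) \<and> F = (\<Sum>i\<in>{1..Suc r}. M i ^ d)"
  proof (intro exI[of _ "\<lambda>i. linear_form n (L (i - 1))"] conjI ballI)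
    show "F = (\<Sum>i\<in>{1..Suc r}. linear_form n (L (i - 1)) ^ d)"
      unfolding F by (rule sum.reindex_bij_witness[of _ "\<lambda>i. i - 1" Suc]) auto
  qed (rule linear_form_in_forms)
next
  fix s :: nat
  assume "\<exists>M. (\<forall>i\<in>{1..s}. M i \<in> forms {..n} 1) \<and> F = (\<Sum>i\<in>{1..s}. M i ^ d)"
  then obtain M where M: "\<And>i. i \<in> {1..s} \<Longrightarrow> M i \<in> forms {..n} 1" "F = (\<Sum>i\<in>{1..s}. M i ^ d)"
    by blast
  show "Suc r \<le> s"
  proof (rule ccontr)
    assume "\<not> Suc r \<le> s"
    then have "s \<le> r"
      by simp
    define L' where "L' i = (if i < s then linear_coeff (M (Suc i)) else (\<lambda>_. 0))" for i
    have "(\<Sum>i\<le>r. linear_form n (L' i) ^ d) = (\<Sum>i<s. linear_form n (L' i) ^ d)"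
      using \<open>s \<le> r\<close> \<open>3 \<le> d\<close> linear_form_zero[of n "\<lambda>_. 0"]
      by (intro sum.mono_neutral_right) (auto simp: L'_def)
    also have "\<dots> = F"
      unfolding M(2)
      by (rule sum.reindex_bij_witness[of _ "\<lambda>i. i - 1" Suc])
        (auto simp: L'_def linear_form_linear_coeff[OF M(1), symmetric])
    finally have "F = (\<Sum>i\<le>r. linear_form n (L' i) ^ d)"
      by simp
    moreover have "(\<Prod>i\<le>r. L' i j ^ (d - 2)) = 0"
      using \<open>s \<le> r\<close> \<open>3 \<le> d\<close> by (auto simp: L'_def intro!: bexI[of _ r])
    ultimately show False
      using nz minor_power_sum[of j n d L' r g] assms(2,3) by simp
  qed
qed

text \<open>By orthogonality the gradient \<open>d \<Sum> (L\<^sub>i \<bullet> L\<^sub>0)\<^sup>d\<^sup>-\<^sup>1 L\<^sub>i\<close> of \<open>F = \<Sum> L\<^sub>i\<^sup>d\<close> at \<open>L\<^sub>0\<close> reduces to its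
  \<open>i = 0\<close> term, a multiple of \<open>L\<^sub>0\<close>.\<close>

lemma distinguished_form_is_eigenvector:
  assumes "linear_form n (eigen_config n t 0) \<noteq> 0" and "2 \<le> d"
  shows "pt (linear_form n (eigen_config n t 0)) \<in> eig n (eigen_form n r d t)"
proof -
  let ?L = "eigen_config n t"
  let ?x = "linear_coeff (linear_form n (?L 0))"
  let ?c = "of_nat d * (\<Sum>l\<le>n. ?L 0 l * ?L 0 l) ^ (d - 1)"
  have gradient: "poly_eval ?x (partial_deriv l (eigen_form n r d t)) = ?c * ?L 0 l" if "l \<le> n" for l
  proof -
    have "poly_eval ?x (partial_deriv l (eigen_form n r d t)) =
        (\<Sum>i\<le>r. of_nat d * (\<Sum>l\<le>n. ?L i l * ?L 0 l) ^ (d - 1) * ?L i l)"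
      unfolding eigen_form_def gradient_power_sum[OF that]
      by (simp add: linear_coeff_linear_form)
    also have "\<dots> = (\<Sum>i\<in>{0}. of_nat d * (\<Sum>l\<le>n. ?L i l * ?L 0 l) ^ (d - 1) * ?L i l)"
      using \<open>2 \<le> d\<close> eigen_config_orthogonal[of _ n t]
      by (intro sum.mono_neutral_right) (auto simp: power_0_left)
    finally show ?thesis
      by simp
  qed
  have "poly_eval ?x (partial_deriv i (eigen_form n r d t)) * ?x j -
      poly_eval ?x (partial_deriv j (eigen_form n r d t)) * ?x i = 0" if "i \<le> n" "j \<le> n" for i j
    unfolding gradient[OF that(1)] gradient[OF that(2)]
    using that by (simp add: linear_coeff_linear_form)
  then show ?thesis
    unfolding eig_def using assms(1) linear_form_in_forms by blast
qed

text \<open>The nonvanishing minor forces the rank to be \<open>r + 1\<close>. The defining decomposition is then a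
  minimal one, and so its summand \<open>L\<^sub>0\<close> lies in the Waring locus as well as in the eigenscheme.\<close>

lemma eigen_form_in_critical_waring_variety:
  assumes "j \<le> n" "3 \<le> d"
    and nz: "poly_eval (coeff (eigen_form n r d t)) (minor n d j r g) \<noteq> 0"
  shows "pt (eigen_form n r d t) \<in> critical_waring_variety n (r + 1) d"
proof -
  let ?F = "eigen_form n r d t"
  define L where "L i = linear_form n (eigen_config n t i)" for i
  have F: "?F = (\<Sum>i\<le>r. linear_form n (eigen_config n t i) ^ d)"
    by (simp add: eigen_form_def)
  have rank: "waring_rank n d ?F = Suc r"
    by (rule waring_rank_eqI[OF F assms])
  have "eigen_config n t i j \<noteq> 0" if "i \<le> r" for i
    using nz that \<open>3 \<le> d\<close> minor_power_sum[of j n d "eigen_config n t" r g] \<open>j \<le> n\<close>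
    by (auto simp: F)
  then have L: "L i \<noteq> 0" if "i \<le> r" for i
    using linear_coeff_linear_form[of n "eigen_config n t i" j] that \<open>j \<le> n\<close>
    by (auto simp: L_def linear_coeff_def)
  have L_forms: "L i \<in> forms {..n} 1" for i
    unfolding L_def by (rule linear_form_in_forms)
  have F': "?F = (\<Sum>i\<le>r. L i ^ d)"
    by (simp add: F L_def)
  have "?F \<noteq> 0"
  proof
    assume "?F = 0"
    then have "waring_rank n d ?F = 0"
      by (simp add: waring_rank_def)
    then show False
      using rank by simp
  qed
  moreover have "pt ?F \<in> secant_open n (r + 1) d"
    unfolding secant_open_def
  proof (rule UN_I)
    let ?p = "\<lambda>i. pt (L (i - 1) ^ d)"
    show "?p \<in> {p. \<forall>i\<in>{1..r + 1}. p i \<in> veronese n d}"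
      using L L_forms unfolding veronese_def by fastforce
    have "L i ^ d \<in> \<Union> (?p ` {1..r + 1})" if "i \<le> r" for i
    proof (rule UnionI)
      show "?p (Suc i) \<in> ?p ` {1..r + 1}"
        using that by (intro imageI) simp
      show "L i ^ d \<in> ?p (Suc i)"
        by (simp add: pt_def cpoly.span_base)
    qed
    then have "?F \<in> cpoly.span (\<Union> (?p ` {1..r + 1}))"
      unfolding F' by (intro cpoly.span_sum cpoly.span_base) simp
    then show "pt ?F \<in> proj_span (?p ` {1..r + 1})"
      unfolding proj_span_def using \<open>?F \<noteq> 0\<close> by blast
  qed
  moreover have "pt (L 0) \<in> waring_locus n d ?F"
  proof -
    let ?A = "insert (L 0 ^ d) ((\<lambda>i. L (i - 1) ^ d) ` {2..Suc r})"
    have "L i ^ d \<in> ?A" if "i \<le> r" for i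
      using that by (cases "i = 0") (auto intro!: image_eqI[of _ _ "Suc i"])
    then have "?F \<in> cpoly.span ?A"
      unfolding F' by (intro cpoly.span_sum cpoly.span_base) simp
    then show ?thesis
      unfolding waring_locus_def rank using L[of 0] L_forms
      by (auto intro!: exI[of _ "L 0"] exI[of _ "\<lambda>i. L (i - 1)"])
  qed
  moreover have "pt (L 0) \<in> eig n ?F"
    using distinguished_form_is_eigenvector L[of 0] \<open>3 \<le> d\<close> by (simp add: L_def)
  ultimately have "pt ?F \<in> {pt F | F. F \<in> forms {..n} d \<and> F \<noteq> 0 \<and> pt F \<in> secant_open n (r + 1) d \<and>
      waring_locus n d F \<inter> eig n F \<noteq> {}}" (is "_ \<in> ?E")
    using eigen_form_in_forms by blast
  moreover have "?E \<subseteq> topspace (zariski n d)"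
    by (auto simp: topspace_zariski proj_forms_def)
  ultimately show ?thesis
    unfolding critical_waring_variety_def using closure_of_subset by blast
qed


section \<open>The chain\<close>

abbreviation stage :: "nat \<Rightarrow> nat \<Rightarrow> nat \<Rightarrow> nat \<Rightarrow> nat cpoly set"
  where "stage n r d s \<equiv> eigen_form n r d ` first_parameters n s"

lemma stage_subset_forms: "stage n r d s \<subseteq> forms {..n} d"
  using eigen_form_in_forms by blast

lemma first_parameters_mono: "s \<le> s' \<Longrightarrow> first_parameters n s \<subseteq> first_parameters n s'"
  unfolding first_parameters_def by (intro Collect_mono) (metis le_less_trans)

text \<open>With all parameters zero the form is \<open>x\<^sub>0\<^sup>d\<close>.\<close>

lemma stage_nonzero:
  assumes "d > 0"
  shows "\<exists>F\<in>stage n r d s. F \<noteq> 0"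
proof (rule bexI)
  show mem: "eigen_form n r d (\<lambda>_ _. 0) \<in> stage n r d s"
    by (simp add: first_parameters_def)
  have "eigen_form n r d (\<lambda>_ _. 0) = eigen_form n 0 d (\<lambda>_ _. 0)"
    by (rule eigen_form_truncate[of _ n 0]) (use assms in \<open>auto simp: first_parameters_def\<close>)
  then have "coeff (eigen_form n r d (\<lambda>_ _. 0)) (Poly_Mapping.single 0 d) =
      of_nat (multinomial n d (Poly_Mapping.single 0 d))"
    using assms by (simp add: eigen_form_def coeff_linear_form_power monomial_eval_def eigen_config_def)
  moreover have "multinomial n d (Poly_Mapping.single 0 d) > 0"
    by (rule multinomial_pos) (use assms in \<open>auto simp: monomials_def\<close>)
  ultimately show "eigen_form n r d (\<lambda>_ _. 0) \<noteq> 0"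
    by auto
qed

lemma poly_eval_form_at_zero:
  assumes "G \<in> forms I (Suc e)"
  shows "poly_eval (coeff 0) G = 0"
  using poly_eval_smul_form[OF assms, of 0 0] by (simp add: coeff_smul zero_poly_mapping.rep_eq)

text \<open>Before parameter number \<open>k n + j\<close> becomes available, only \<open>L\<^sub>0, \<dots>, L\<^sub>k\<close> contribute
  and \<open>(L\<^sub>k)\<^sub>j = 0\<close>, so the product formula gives \<open>0\<close>. The exponent \<open>d - 2\<close> is positive
  because \<open>d \<ge> 3\<close>.\<close>

lemma minor_vanishes_on_stage:
  assumes s: "s < k * n + j" and j: "1 \<le> j" "j \<le> n" and "k \<le> r" "3 \<le> d"
    and F: "F \<in> stage n r d s"
  shows "poly_eval (coeff F) (minor n d j k g) = 0"
proof -
  obtain t where t: "t \<in> first_parameters n s" "F = eigen_form n r d t"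
    using F by blast
  have F': "F = (\<Sum>i\<le>k. linear_form n (eigen_config n t i) ^ d)"
    unfolding t(2) using eigen_form_truncate[OF t(1), of k r d] s j \<open>k \<le> r\<close> \<open>3 \<le> d\<close>
    by (simp add: eigen_form_def)
  have "eigen_config n t k j = 0"
    using t(1) s j by (auto simp: first_parameters_def eigen_config_def)
  then have "(\<Prod>i\<le>k. eigen_config n t i j ^ (d - 2)) = 0"
    using \<open>3 \<le> d\<close> by (auto intro!: bexI[of _ k])
  then show ?thesis
    unfolding F' using minor_power_sum[of j n d "eigen_config n t" k g] j \<open>3 \<le> d\<close> by simp
qed

lemma minor_nonzero_on_stage:
  assumes j: "1 \<le> j" "j \<le> n" and "k \<le> r" "r \<le> n" "3 \<le> d"
  obtains F g where "F \<in> stage n r d (k * n + j)" "F \<noteq> 0"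
    "poly_eval (coeff F) (minor n d j k g) \<noteq> 0"
proof -
  obtain t g where t: "t \<in> first_parameters n (k * n + j)"
      "mat (Suc k) (Suc k) (\<lambda>(p, i). \<Sum>s\<le>n. g p s * eigen_config n t i s) = 1\<^sub>m (Suc k)"
      "\<forall>i\<le>k. eigen_config n t i j \<noteq> 0"
    using exists_config_with_minor[OF j order_trans[OF \<open>k \<le> r\<close> \<open>r \<le> n\<close>]] by blast
  let ?F = "eigen_form n r d t"
  have F: "?F = (\<Sum>i\<le>k. linear_form n (eigen_config n t i) ^ d)"
    using eigen_form_truncate[OF t(1), of k r d] j \<open>k \<le> r\<close> \<open>3 \<le> d\<close> by (simp add: eigen_form_def)
  have nz: "poly_eval (coeff ?F) (minor n d j k g) \<noteq> 0"
    unfolding F using minor_power_sum[of j n d "eigen_config n t" k g] j \<open>3 \<le> d\<close> t(2,3) by simp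
  moreover have "?F \<noteq> 0"
    using nz poly_eval_form_at_zero[OF minor_in_forms[of j n d k g]] j \<open>3 \<le> d\<close> by fastforce
  ultimately show ?thesis
    using that t(1) by blast
qed

theorem theorem4p14:
  fixes n r d :: nat
  assumes "1 \<le> r" and "r \<le> n" and "d \<ge> 3"
  shows "krull_dim (subtopology (zariski n d) (critical_waring_variety n (r + 1) d))
    \<ge> enat (r * (n + 1))"
proof -
  define V where "V = critical_waring_variety n (r + 1) d"
  define Z where "Z s = cone_closure n d (stage n r d s)" for s
  have closed: "closedin (zariski n d) V"
    by (simp add: V_def critical_waring_variety_def)
  \<comment> \<open>The last minor, with \<open>k = r\<close> and \<open>j = n\<close>, describes the generic elements of the largest stage.\<close>
  have in_V: "Z s \<subseteq> V" if "s \<le> r * n + n" for s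
  proof -
    obtain F g where F: "F \<in> stage n r d (r * n + n)" "F \<noteq> 0"
        "poly_eval (coeff F) (minor n d n r g) \<noteq> 0"
      using minor_nonzero_on_stage[of n n r r d] assms by auto
    have "Z (r * n + n) \<subseteq> V"
      unfolding Z_def
    proof (rule cone_closure_generic_subset[OF joined_by_curves_eigen_forms stage_subset_forms closed F])
      fix F'
      assume "F' \<in> stage n r d (r * n + n)" "poly_eval (coeff F') (minor n d n r g) \<noteq> 0"
      then show "pt F' \<in> V"
        unfolding V_def using eigen_form_in_critical_waring_variety[of n n d r _ g] assms(3) by blast
    qed
    moreover have "Z s \<subseteq> Z (r * n + n)"
      unfolding Z_def by (intro cone_closure_mono image_mono first_parameters_mono that)
    ultimately show ?thesis
      by blast
  qed
  have irreducible: "irreducible_closedin (zariski n d) (Z s)" for s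
  proof -
    obtain W where W: "W \<in> stage n r d s" "W \<noteq> 0"
      using stage_nonzero[of d n r s] assms(3) by auto
    show ?thesis
      unfolding Z_def
      by (rule irreducible_cone_closure[OF joined_by_curves_eigen_forms stage_subset_forms W])
  qed
  have strict: "Z s \<subset> Z (Suc s)" if "s < r * n + n" for s
  proof
    show "Z s \<subseteq> Z (Suc s)"
      unfolding Z_def by (intro cone_closure_mono image_mono first_parameters_mono) simp
    \<comment> \<open>Parameter number \<open>s + 1\<close> is \<open>t k j\<close>.\<close>
    define k j where "k = s div n" and "j = s mod n + 1"
    have s: "Suc s = k * n + j"
      by (simp add: k_def j_def)
    have j: "1 \<le> j" "j \<le> n"
      using assms by (simp_all add: j_def Suc_leI)
    have "k < Suc r"
      using that unfolding k_def by (intro less_mult_imp_div_less) simp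
    then have "k \<le> r"
      by simp
    obtain F g where F: "F \<in> stage n r d (k * n + j)" "F \<noteq> 0"
        "poly_eval (coeff F) (minor n d j k g) \<noteq> 0"
      using minor_nonzero_on_stage[OF j \<open>k \<le> r\<close> assms(2,3)] by blast
    have F_forms: "F \<in> forms {..n} d"
      using F(1) stage_subset_forms by blast
    have "minor n d j k g \<in> vanishing_forms n d (stage n r d s)"
      using minor_vanishes_on_stage[OF _ j \<open>k \<le> r\<close> assms(3), of s] minor_in_forms[of j n d k g] s j assms(3)
      unfolding vanishing_forms_def coord_forms_def by auto
    then have "pt F \<notin> Z s"
      unfolding Z_def cone_closure_def pt_in_zero_locus_iff[OF F_forms F(2) vanishing_forms_subset]
      using F(3) by blast
    moreover have "pt F \<in> Z (Suc s)"
      unfolding Z_def s by (rule pt_in_cone_closure[OF F(1) F_forms F(2)])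
    ultimately show "Z s \<noteq> Z (Suc s)"
      by blast
  qed
  have "enat (r * n + n) \<le> krull_dim (subtopology (zariski n d) V)"
    by (rule krull_dim_ge[where Z = Z])
      (use irreducible_closedin_subtopology[OF closed in_V irreducible] strict in blast)+
  \<comment> \<open>The family has \<open>r n + n\<close> parameters, and \<open>r \<le> n\<close>.\<close>
  moreover have "enat (r * (n + 1)) \<le> enat (r * n + n)"
    using assms(2) by simp
  ultimately show ?thesis
    unfolding V_def by (rule order_trans[rotated])
qed

end
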